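(* Let $\mathcal{L}=\sum_n \mathsf{L}(n,\mathbf{u}_0,\dots,\mathbf{u}_J)$ be a functional whose Lagrangian $\mathsf{L}$ is invariant under the action of an $R$-dimensional Lie group $G$, let $\rho_k=\mathrm{S}_k\rho_0$ be a right difference moving frame with generating invariants $\boldsymbol{\kappa}$, write $\mathcal{L}=\sum_n L(n,\boldsymbol{\kappa}_0,\dots,\boldsymbol{\kappa}_{J_1})$ with $\boldsymbol{\kappa}_j=\mathrm{S}_j\boldsymbol{\kappa}$, and let the differential–difference syzygies be $\mathrm{d}\boldsymbol{\kappa}/\mathrm{d}t=\mathcal{H}\boldsymbol{\sigma}$, with $\sigma^\alpha=\rho_0\cdot(u_0^\alpha)'$ and $\mathcal{H}$ a matrix of linear difference operators whose coefficients are functions of $\boldsymbol{\kappa}$ and its shifts. Let $A_{\mathcal{H}}=\mathcal{C}^{j}_{\alpha}\,\mathrm{S}_j(\sigma^{\alpha})$ (summed over $j,\alpha$) be the boundary term, linear in the $\sigma^\alpha$ and their shifts, defined by $\mathrm{E}_{\boldsymbol{\kappa}}(L)\cdot\mathcal{H}\boldsymbol{\sigma}-(\mathcal{H}^*\mathrm{E}_{\boldsymbol{\kappa}}(L))\cdot\boldsymbol{\sigma}=(\mathrm{S}-\mathrm{id})A_{\mathcal{H}}$, where each $\mathcal{C}^j_\alpha$ depends only on $n$, $\boldsymbol{\kappa}$ and its shifts, and let $$V(I)=\mathcal{C}_{\alpha}^j\big(\mathrm{S}_j\Phi^{\alpha}_{0}(I)\big)\,\mathcal{A}d\big(\rho_j\rho_{0}^{-1}\big)\quad(\text{summed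 over } j,\alpha),\qquad \Phi^{\alpha}_0(I)=\Phi^{\alpha}(\rho_0\cdot\mathbf{u}_0),$$ where $\Phi^\alpha$ is the row of the matrix of characteristics corresponding to $u^\alpha$. Then on any solution of the invariantized Euler–Lagrange equations $\mathcal{H}^*\mathrm{E}_{\boldsymbol{\kappa}}(L)=0$, $$V(I)\,\mathcal{A}d(\rho_{0})=c,$$ for some constant row vector $c=(c_1\ \cdots\ c_R)$ (independent of $n$).
   Context: Setting. The independent variable is $n$ ranging over an interval of $\mathbb{Z}$; the dependent variables are $\mathbf{u}=(u^1,\dots,u^q)\in U\subset\mathbb{R}^q$, and $\mathbf{u}_j=\mathbf{u}(n+j)$. The shift operator is $\mathrm{S}:n\mapsto n+1$, $\mathrm{S}:u^\alpha_j\mapsto u^\alpha_{j+1}$, with powers $\mathrm{S}_j=\mathrm{S}^j$, $j\in\mathbb{Z}$; $\mathrm{id}$ is the identity operator. All calculations are formal, local and smooth. Repeated indices are summed. The prolongation space $P_n^{(J_0,J)}(U)$, $J_0\le0\le J$, over an arbitrary base point $n$ is the product of $J-J_0+1$ copies of $U$ with coordinates $z=(\mathbf{u}_{J_0},\dots,\mathbf{u}_J)$; prolongation spaces are taken as large as needed. Group action and frame. A Lie group $G$ of dimension $R$ acts smoothly (left action) on $U$ and diagonally on prolongation spaces; the action on the relevant prolongation space (or a suitable domain of it) is free and regular. A right moving frame is a map $\rho_0$ from (a domain in) the prolongation space to $G$ with $\rho_0(g\cdot z)=\rho_0(z)g^{-1}$, determined by a cross-section $\mathcal{K}_0$ transverse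 to the orbits: $\rho_0(z)$ is the unique group element taking $z$ to $\mathcal{K}_0$. A difference moving frame is the sequence $\rho_k=\mathrm{S}_k\rho_0$. A set of invariants is generating if every difference invariant is a function of its elements and their shifts. Variations. Let $\mathbf{u}=\mathbf{u}(t)$ depend smoothly on an auxiliary parameter $t$ (invariant under $G$), with $'=\mathrm{d}/\mathrm{d}t$; $\rho_0\cdot (u_0^\alpha)'=\big(\tfrac{\mathrm{d}}{\mathrm{d}t}(g\cdot u_0^\alpha)\big)\big|_{g=\rho_0}$ (group element held fixed while differentiating). Operators. $\mathrm{E}_{\kappa^\beta}(L)=\sum_j\mathrm{S}_{-j}\big(\partial L/\partial\kappa^\beta_j\big)$. The adjoint of $\mathcal{H}=\sum_j c_j\mathrm{S}_j$ is $\mathcal{H}^*(F)=\sum_j\mathrm{S}_{-j}(c_jF)$; for a matrix of operators, $(\mathcal{H}^* )_{\alpha\beta}=(\mathcal{H}_{\beta\alpha})^*$. Infinitesimals. Parametrize $G$ near the identity $e$ by $\mathbf{a}=(a^1,\dots,a^R)\mapsto\Gamma(\mathbf{a})$, $\Gamma(\mathbf{0})=e$. The infinitesimal generators are $\mathbf{v}_r=\xi^\alpha_r(\mathbf{u})\partial_{u^\alpha}$, $\xi_r^\alpha(\mathbf{u})=\partial(\Gamma(\mathbf{a})\cdot\mathbf{u})^\alpha/\partial a^r|_{\mathbf{a}=\mathbf{0}}$; they are taken to form a basis of the space of infinitesimal generators. The matrix of characteristics is the $q\times R$ matrix $\Phi(\mathbf{u})=(\xi_r^\alpha(\mathbf{u}))$,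 with rows $\Phi^\alpha$. For $g\in G$, with $\widetilde{\mathbf{u}}=g\cdot\mathbf{u}$ and $\widetilde{\mathbf{v}}_r=\xi_r^\alpha(\widetilde{\mathbf{u}})\partial_{\tilde u^\alpha}$, the $R\times R$ matrix $\mathcal{A}d(g)$ (adjoint representation) is defined by $(\mathbf{v}_1\ \cdots\ \mathbf{v}_R)=(\widetilde{\mathbf{v}}_1\ \cdots\ \widetilde{\mathbf{v}}_R)\,\mathcal{A}d(g)$. *)

theory Defs
  imports "HOL-Analysis.Analysis" "HOL-Algebra.Group_Action"
begin

section \<open>Smooth maps\<close>

text \<open>The two notions of smoothness below are meant for open sets \<open>S\<close> and \<open>W\<close>.\<close>

primrec Ck_on :: "nat \<Rightarrow> ('a::euclidean_space \<Rightarrow> 'b::real_normed_vector) \<Rightarrow> 'a set \<Rightarrow> bool" where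
  "Ck_on 0 f S \<longleftrightarrow> continuous_on S f"
| "Ck_on (Suc k) f S \<longleftrightarrow>
     (\<exists>f'. (\<forall>x\<in>S. (f has_derivative f' x) (at x)) \<and> (\<forall>v. Ck_on k (\<lambda>x. f' x v) S))"

definition smooth_on :: "('a::euclidean_space \<Rightarrow> 'b::real_normed_vector) \<Rightarrow> 'a set \<Rightarrow> bool" where
  "smooth_on f S \<longleftrightarrow> (\<forall>k. Ck_on k f S)"

text \<open>Functions on prolongation spaces are written as functions of a bi-infinite sequence
  \<open>x\<close> that depend on finitely many of the \<open>x j\<close> only; sequences carry the product topology.
  \<open>partial_wrt j \<beta> F\<close> is the partial derivative of \<open>F\<close> with respect to
  the component \<open>\<beta>\<close> of \<open>x j\<close>.\<close>

definition depends_on :: "int set \<Rightarrow> ((int \<Rightarrow> 'a) \<Rightarrow> 'b) \<Rightarrow> bool" where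
  "depends_on A F \<longleftrightarrow> (\<forall>x y. (\<forall>j\<in>A. x j = y j) \<longrightarrow> F x = F y)"

definition partial_wrt ::
  "int \<Rightarrow> 'k::finite \<Rightarrow> ((int \<Rightarrow> real^'k) \<Rightarrow> 'b::real_normed_vector) \<Rightarrow> (int \<Rightarrow> real^'k) \<Rightarrow> 'b" where
  "partial_wrt j \<beta> F x = vector_derivative (\<lambda>s. F (x(j := x j + s *\<^sub>R axis \<beta> 1))) (at 0)"

primrec seq_Ck_on ::
  "nat \<Rightarrow> ((int \<Rightarrow> real^'k::finite) \<Rightarrow> 'b::real_normed_vector) \<Rightarrow> (int \<Rightarrow> real^'k) set \<Rightarrow> bool" where
  "seq_Ck_on 0 F W \<longleftrightarrow> continuous_on W F"
| "seq_Ck_on (Suc k) F W \<longleftrightarrow> continuous_on W F \<and>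
     (\<forall>j \<beta>. (\<forall>x\<in>W. (\<lambda>s. F (x(j := x j + s *\<^sub>R axis \<beta> 1))) differentiable (at 0)) \<and>
            seq_Ck_on k (partial_wrt j \<beta> F) W)"

definition seq_smooth_on ::
  "((int \<Rightarrow> real^'k::finite) \<Rightarrow> 'b::real_normed_vector) \<Rightarrow> (int \<Rightarrow> real^'k) set \<Rightarrow> bool" where
  "seq_smooth_on F W \<longleftrightarrow> (\<forall>k. seq_Ck_on k F W)"

definition seq_smooth_near ::
  "((int \<Rightarrow> real^'k::finite) \<Rightarrow> 'b::real_normed_vector) \<Rightarrow> (int \<Rightarrow> real^'k) set \<Rightarrow> bool" where
  "seq_smooth_near F X \<longleftrightarrow> (\<exists>W. open W \<and> X \<subseteq> W \<and> seq_smooth_on F W)"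


section \<open>Lie groups and smooth actions\<close>

type_synonym ('g, 'r) chart = "'g set \<times> ('g \<Rightarrow> real^'r)"

definition is_chart :: "'g topology \<Rightarrow> ('g, 'r::finite) chart \<Rightarrow> bool" where
  "is_chart T = (\<lambda>(W, \<phi>). openin T W \<and> open (\<phi> ` W) \<and>
     homeomorphic_map (subtopology T W) (top_of_set (\<phi> ` W)) \<phi>)"

definition compatible_charts :: "('g, 'r::finite) chart \<Rightarrow> ('g, 'r) chart \<Rightarrow> bool" where
  "compatible_charts = (\<lambda>(W, \<phi>) (W', \<phi>').
     smooth_on (\<phi>' \<circ> inv_into W \<phi>) (\<phi> ` (W \<inter> W')) \<and>
     smooth_on (\<phi> \<circ> inv_into W' \<phi>') (\<phi>' ` (W \<inter> W')))"

definition smooth_into ::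
  "'g topology \<Rightarrow> ('g, 'r::finite) chart set \<Rightarrow> ('a::euclidean_space \<Rightarrow> 'g) \<Rightarrow> 'a set \<Rightarrow> bool" where
  "smooth_into T \<A> f S \<longleftrightarrow> continuous_map (top_of_set S) T f \<and>
     (\<forall>(W, \<phi>)\<in>\<A>. smooth_on (\<phi> \<circ> f) {x \<in> S. f x \<in> W})"

text \<open>A Lie group of dimension \<open>CARD('r)\<close> with smooth atlas \<open>\<A>\<close>.\<close>

locale lie_group = group G for G :: "'g monoid" (structure) +
  fixes T :: "'g topology" and \<A> :: "('g, 'r::finite) chart set"
  assumes topspace: "topspace T = carrier G"
    and Hausdorff: "Hausdorff_space T"
    and second_countable: "second_countable T"
    and charts: "\<And>c. c \<in> \<A> \<Longrightarrow> is_chart T c"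
    and compatible: "\<And>c c'. c \<in> \<A> \<Longrightarrow> c' \<in> \<A> \<Longrightarrow> compatible_charts c c'"
    and covering: "\<Union> (fst ` \<A>) = carrier G"
    and continuous_mult: "continuous_map (prod_topology T T) T (\<lambda>(g, h). g \<otimes> h)"
    and smooth_mult: "\<And>W \<phi> W' \<phi>'. (W, \<phi>) \<in> \<A> \<Longrightarrow> (W', \<phi>') \<in> \<A> \<Longrightarrow>
      smooth_into T \<A> (\<lambda>(x, y). inv_into W \<phi> x \<otimes> inv_into W' \<phi>' y) (\<phi> ` W \<times> \<phi>' ` W')"
    and smooth_inv: "\<And>W \<phi>. (W, \<phi>) \<in> \<A> \<Longrightarrow>
      smooth_into T \<A> (\<lambda>x. inv (inv_into W \<phi> x)) (\<phi> ` W)"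

text \<open>A smooth parametrization \<open>\<Gamma>\<close>, defined on \<open>\<Omega>\<close>, of a neighbourhood of the
  identity: its inverse is a chart that is compatible with the atlas.\<close>

definition parametrization_at_one ::
  "'g monoid \<Rightarrow> 'g topology \<Rightarrow> ('g, 'r::finite) chart set \<Rightarrow> (real^'r) set \<Rightarrow> (real^'r \<Rightarrow> 'g) \<Rightarrow> bool" where
  "parametrization_at_one G T \<A> \<Omega> \<Gamma> \<longleftrightarrow>
     open \<Omega> \<and> 0 \<in> \<Omega> \<and> \<Gamma> 0 = \<one>\<^bsub>G\<^esub> \<and> inj_on \<Gamma> \<Omega> \<and>
     is_chart T (\<Gamma> ` \<Omega>, inv_into \<Omega> \<Gamma>) \<and>
     (\<forall>c\<in>\<A>. compatible_charts (\<Gamma> ` \<Omega>, inv_into \<Omega> \<Gamma>) c)"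

definition smooth_action ::
  "'g monoid \<Rightarrow> ('g, 'r::finite) chart set \<Rightarrow> (real^'q::finite) set \<Rightarrow> ('g \<Rightarrow> real^'q \<Rightarrow> real^'q) \<Rightarrow> bool" where
  "smooth_action G \<A> U act \<longleftrightarrow> group_action G U act \<and>
     (\<forall>(W, \<phi>)\<in>\<A>. smooth_on (\<lambda>(x, u). act (inv_into W \<phi> x) u) (\<phi> ` W \<times> U))"

text \<open>Entry \<open>\<Phi> u $ \<alpha> $ r\<close> of the matrix of characteristics is the component
  \<open>\<xi>\<close> of the \<open>r\<close>-th infinitesimal generator with respect to \<open>u\<^sup>\<alpha>\<close>.\<close>

definition characteristics ::
  "(real^'r::finite \<Rightarrow> 'g) \<Rightarrow> ('g \<Rightarrow> real^'q::finite \<Rightarrow> real^'q) \<Rightarrow> real^'q \<Rightarrow> real^'r^'q" where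
  "characteristics \<Gamma> act u =
     (\<chi> \<alpha> r. vector_derivative (\<lambda>s. act (\<Gamma> (s *\<^sub>R axis r 1)) u) (at 0) $ \<alpha>)"

definition independent_generators ::
  "(real^'r::finite \<Rightarrow> 'g) \<Rightarrow> (real^'q::finite) set \<Rightarrow> ('g \<Rightarrow> real^'q \<Rightarrow> real^'q) \<Rightarrow> bool" where
  "independent_generators \<Gamma> U act \<longleftrightarrow>
     (\<forall>c. (\<forall>u\<in>U. characteristics \<Gamma> act u *v c = 0) \<longrightarrow> c = 0)"

text \<open>With \<open>w = g \<cdot> u\<close>, the vector field \<open>\<partial>/\<partial>u\<^sup>\<alpha>\<close> is
  \<open>(\<partial>w\<^sup>\<beta>/\<partial>u\<^sup>\<alpha>) \<partial>/\<partial>w\<^sup>\<beta>\<close>. Comparing the coefficients of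
  \<open>\<partial>/\<partial>w\<^sup>\<beta>\<close>, the equation
  \<open>(v\<^sub>1 \<dots> v\<^sub>R) = (v'\<^sub>1 \<dots> v'\<^sub>R) Ad(g)\<close> between the generators in the
  coordinates \<open>u\<close> and in the coordinates \<open>w\<close> is the matrix equation below.\<close>

definition Ad ::
  "(real^'r::finite \<Rightarrow> 'g) \<Rightarrow> (real^'q::finite) set \<Rightarrow> ('g \<Rightarrow> real^'q \<Rightarrow> real^'q) \<Rightarrow> 'g \<Rightarrow> real^'r^'r" where
  "Ad \<Gamma> U act g = (THE M. \<forall>u\<in>U.
     matrix (frechet_derivative (act g) (at u)) ** characteristics \<Gamma> act u
       = characteristics \<Gamma> act (act g u) ** M)"


section \<open>Prolongation spaces and difference moving frames\<close>

text \<open>The prolongation space with coordinates \<open>u j\<close>, \<open>J0 \<le> j \<le> J\<close>, its diagonal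
  action, and the point of it obtained from a sequence \<open>z\<close> by the \<open>k\<close>-th shift. Hence for a
  function \<open>F\<close> on the prolongation space, \<open>\<lambda>z. F (window J0 J k z)\<close> is
  the \<open>k\<close>-th shift of \<open>F\<close>.\<close>

definition prolong :: "int \<Rightarrow> int \<Rightarrow> 'a set \<Rightarrow> (int \<Rightarrow> 'a) set" where
  "prolong J0 J U = (\<Pi>\<^sub>E j\<in>{J0..J}. U)"

definition diag_act :: "int \<Rightarrow> int \<Rightarrow> ('g \<Rightarrow> 'a \<Rightarrow> 'a) \<Rightarrow> 'g \<Rightarrow> (int \<Rightarrow> 'a) \<Rightarrow> (int \<Rightarrow> 'a)" where
  "diag_act J0 J act g z = (\<lambda>j\<in>{J0..J}. act g (z j))"

definition window :: "int \<Rightarrow> int \<Rightarrow> int \<Rightarrow> (int \<Rightarrow> 'a) \<Rightarrow> (int \<Rightarrow> 'a)" where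
  "window J0 J k z = (\<lambda>j\<in>{J0..J}. z (j + k))"

text \<open>Sequences all of whose windows shifted by \<open>a, \<dots>, b\<close> lie in the domain \<open>D\<close>;
  this is the domain in the prolongation space with coordinates \<open>J0 + a, \<dots>, J + b\<close>
  on which shifts by \<open>a, \<dots>, b\<close> of functions on \<open>D\<close> are defined.\<close>

definition admissible :: "int \<Rightarrow> int \<Rightarrow> (int \<Rightarrow> 'a) set \<Rightarrow> int \<Rightarrow> int \<Rightarrow> (int \<Rightarrow> 'a) set" where
  "admissible J0 J D a b = {z. \<forall>k\<in>{a..b}. window J0 J k z \<in> D}"

definition free_on :: "'g monoid \<Rightarrow> ('g \<Rightarrow> 'x \<Rightarrow> 'x) \<Rightarrow> 'x set \<Rightarrow> bool" where
  "free_on G A D \<longleftrightarrow> (\<forall>z\<in>D. stabilizer G A z = {\<one>\<^bsub>G\<^esub>})"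

text \<open>Regular action: all points have arbitrarily small neighbourhoods that meet every orbit in
  a path-connected set. Regularity also asks that all orbits have the same dimension, which is
  automatic for the free actions considered here.\<close>

definition regular_on :: "'g monoid \<Rightarrow> ('g \<Rightarrow> 'x::topological_space \<Rightarrow> 'x) \<Rightarrow> 'x set \<Rightarrow> bool" where
  "regular_on G A D \<longleftrightarrow>
     (\<forall>z\<in>D. \<forall>V. openin (top_of_set D) V \<and> z \<in> V \<longrightarrow>
        (\<exists>V'. openin (top_of_set D) V' \<and> z \<in> V' \<and> V' \<subseteq> V \<and>
              (\<forall>w\<in>D. path_connected (V' \<inter> orbit G A w))))"

text \<open>A cross-section is a submanifold of \<open>D\<close> of codimension \<open>CARD('r)\<close>, locally the zero set
  of a smooth \<open>\<psi>\<close>, that is transverse to the orbits: \<open>\<psi>\<close> has invertible derivative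
  along the orbits.\<close>

definition cross_section ::
  "int \<Rightarrow> int \<Rightarrow> (real^'r::finite \<Rightarrow> 'g) \<Rightarrow> ('g \<Rightarrow> real^'q::finite \<Rightarrow> real^'q) \<Rightarrow>
   (int \<Rightarrow> real^'q) set \<Rightarrow> (int \<Rightarrow> real^'q) set \<Rightarrow> bool" where
  "cross_section J0 J \<Gamma> act D K \<longleftrightarrow> K \<subseteq> D \<and>
     (\<forall>z\<in>K. \<exists>V (\<psi> :: (int \<Rightarrow> real^'q) \<Rightarrow> real^'r).
        openin (top_of_set D) V \<and> z \<in> V \<and>
        seq_smooth_on (\<lambda>x. \<psi> (window J0 J 0 x)) {x. window J0 J 0 x \<in> V} \<and>
        K \<inter> V = {w \<in> V. \<psi> w = 0} \<and>
        (\<exists>\<psi>'. ((\<lambda>a. \<psi> (diag_act J0 J act (\<Gamma> a) z)) has_derivative \<psi>') (at 0) \<and> bij \<psi>'))"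

text \<open>The map \<open>\<rho>\<^sub>0\<close> on \<open>D\<close> determined by the cross-section \<open>K\<close>; the
  difference moving frame consists of its shifts. The domain \<open>D\<close> need not be invariant.\<close>

definition right_moving_frame ::
  "'g monoid \<Rightarrow> 'g topology \<Rightarrow> ('g, 'r::finite) chart set \<Rightarrow> int \<Rightarrow> int \<Rightarrow> (real^'r \<Rightarrow> 'g) \<Rightarrow>
   (real^'q::finite) set \<Rightarrow> ('g \<Rightarrow> real^'q \<Rightarrow> real^'q) \<Rightarrow>
   (int \<Rightarrow> real^'q) set \<Rightarrow> (int \<Rightarrow> real^'q) set \<Rightarrow> ((int \<Rightarrow> real^'q) \<Rightarrow> 'g) \<Rightarrow> bool" where
  "right_moving_frame G T \<A> J0 J \<Gamma> U act D K \<rho> \<longleftrightarrow>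
     openin (top_of_set (prolong J0 J U)) D \<and>
     free_on G (diag_act J0 J act) D \<and>
     regular_on G (diag_act J0 J act) D \<and>
     cross_section J0 J \<Gamma> act D K \<and>
     (\<forall>z\<in>D. \<rho> z \<in> carrier G \<and> diag_act J0 J act (\<rho> z) z \<in> K \<and>
        (\<forall>g\<in>carrier G. diag_act J0 J act g z \<in> K \<longrightarrow> g = \<rho> z)) \<and>
     (\<forall>z\<in>D. \<forall>g\<in>carrier G. diag_act J0 J act g z \<in> D \<longrightarrow>
        \<rho> (diag_act J0 J act g z) = \<rho> z \<otimes>\<^bsub>G\<^esub> inv\<^bsub>G\<^esub> g) \<and>
     continuous_map (top_of_set D) T \<rho> \<and>
     (\<forall>(W, \<phi>)\<in>\<A>. seq_smooth_on (\<lambda>x. \<phi> (\<rho> (window J0 J 0 x)))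
        {x. window J0 J 0 x \<in> D \<and> \<rho> (window J0 J 0 x) \<in> W})"

definition moving_frame ::
  "int \<Rightarrow> int \<Rightarrow> ((int \<Rightarrow> 'a) \<Rightarrow> 'g) \<Rightarrow> int \<Rightarrow> (int \<Rightarrow> 'a) \<Rightarrow> 'g" where
  "moving_frame J0 J \<rho> k z = \<rho> (window J0 J k z)"

definition invariant_under ::
  "'g monoid \<Rightarrow> ('g \<Rightarrow> 'a \<Rightarrow> 'a) \<Rightarrow> ((int \<Rightarrow> 'a) \<Rightarrow> 'b) \<Rightarrow> (int \<Rightarrow> 'a) set \<Rightarrow> bool" where
  "invariant_under G act F X \<longleftrightarrow>
     (\<forall>z\<in>X. \<forall>g\<in>carrier G. (\<lambda>j. act g (z j)) \<in> X \<longrightarrow> F (\<lambda>j. act g (z j)) = F z)"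

text \<open>The sequence of the shifts of \<open>\<kappa>\<close>.\<close>

definition kappa_seq ::
  "int \<Rightarrow> int \<Rightarrow> ((int \<Rightarrow> 'a) \<Rightarrow> 'b) \<Rightarrow> (int \<Rightarrow> 'a) \<Rightarrow> (int \<Rightarrow> 'b)" where
  "kappa_seq J0 J \<kappa> z = (\<lambda>j. \<kappa> (window J0 J j z))"

definition generating_invariants ::
  "'g monoid \<Rightarrow> int \<Rightarrow> int \<Rightarrow> ('g \<Rightarrow> real^'q::finite \<Rightarrow> real^'q) \<Rightarrow>
   (int \<Rightarrow> real^'q) set \<Rightarrow> ((int \<Rightarrow> real^'q) \<Rightarrow> real^'k::finite) \<Rightarrow> bool" where
  "generating_invariants G J0 J act D \<kappa> \<longleftrightarrow>
     seq_smooth_on (\<lambda>z. \<kappa> (window J0 J 0 z)) (admissible J0 J D 0 0) \<and>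
     invariant_under G act (\<lambda>z. \<kappa> (window J0 J 0 z)) (admissible J0 J D 0 0) \<and>
     (\<forall>m\<ge>0. \<forall>F :: (int \<Rightarrow> real^'q) \<Rightarrow> real.
        depends_on {J0 - m..J + m} F \<and>
        seq_smooth_on F (admissible J0 J D (- m) m) \<and>
        invariant_under G act F (admissible J0 J D (- m) m) \<longrightarrow>
        (\<exists>m'\<ge>m. \<exists>f. depends_on {- m'..m'} f \<and>
           (\<forall>z\<in>admissible J0 J D (- m') m'. F z = f (kappa_seq J0 J \<kappa> z))))"


section \<open>Difference operators\<close>

text \<open>A difference function \<open>F n x\<close> depends on the base point \<open>n\<close> and on
  finitely many of the variables \<open>x j\<close>, where \<open>x j\<close> is the \<open>j\<close>-th shift of \<open>x 0\<close>.\<close>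

type_synonym ('a, 'b) dfun = "int \<Rightarrow> (int \<Rightarrow> 'a) \<Rightarrow> 'b"

definition Shift :: "int \<Rightarrow> ('a, 'b) dfun \<Rightarrow> ('a, 'b) dfun" where
  "Shift k F = (\<lambda>n x. F (n + k) (\<lambda>j. x (j + k)))"

text \<open>The operator \<open>\<Sum>\<^sub>j c\<^sub>j S\<^sub>j\<close> of order at most \<open>p\<close>, its adjoint, and matrices of
  such operators.\<close>

definition dop :: "int \<Rightarrow> (int \<Rightarrow> ('a, real) dfun) \<Rightarrow> ('a, real) dfun \<Rightarrow> ('a, real) dfun" where
  "dop p c F = (\<lambda>n x. \<Sum>j\<in>{- p..p}. c j n x * Shift j F n x)"

definition dop_adjoint :: "int \<Rightarrow> (int \<Rightarrow> ('a, real) dfun) \<Rightarrow> ('a, real) dfun \<Rightarrow> ('a, real) dfun" where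
  "dop_adjoint p c F = (\<lambda>n x. \<Sum>j\<in>{- p..p}. Shift (- j) (\<lambda>m y. c j m y * F m y) n x)"

definition dop_matrix ::
  "int \<Rightarrow> ('k \<Rightarrow> 'q::finite \<Rightarrow> int \<Rightarrow> ('a, real) dfun) \<Rightarrow> ('q \<Rightarrow> ('a, real) dfun) \<Rightarrow> 'k \<Rightarrow> ('a, real) dfun" where
  "dop_matrix p H F \<beta> = (\<lambda>n x. \<Sum>\<alpha>\<in>UNIV. dop p (H \<beta> \<alpha>) (F \<alpha>) n x)"

definition dop_matrix_adjoint ::
  "int \<Rightarrow> ('k::finite \<Rightarrow> 'q \<Rightarrow> int \<Rightarrow> ('a, real) dfun) \<Rightarrow> ('k \<Rightarrow> ('a, real) dfun) \<Rightarrow> 'q \<Rightarrow> ('a, real) dfun" where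
  "dop_matrix_adjoint p H F \<alpha> = (\<lambda>n x. \<Sum>\<beta>\<in>UNIV. dop_adjoint p (H \<beta> \<alpha>) (F \<beta>) n x)"

text \<open>The difference Euler operator, for \<open>L n\<close> depending on \<open>x 0, \<dots>, x J1\<close>.\<close>

definition euler :: "int \<Rightarrow> (real^'k::finite, real) dfun \<Rightarrow> 'k \<Rightarrow> (real^'k, real) dfun" where
  "euler J1 L \<beta> = (\<lambda>n x. \<Sum>j\<in>{0..J1}. Shift (- j) (\<lambda>m. partial_wrt j \<beta> (L m)) n x)"


section \<open>Variations, syzygies and the boundary term\<close>

text \<open>Difference functions of the pair \<open>(\<kappa>, \<sigma>)\<close>: functions of \<open>\<kappa>\<close> alone, and the
  component \<open>\<sigma>\<^sup>\<alpha>\<close>.\<close>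

definition on_kappa :: "(real^'k, 'b) dfun \<Rightarrow> ((real^'k) \<times> (real^'q), 'b) dfun" where
  "on_kappa f = (\<lambda>n y. f n (\<lambda>j. fst (y j)))"

definition sigma_comp :: "'q \<Rightarrow> ((real^'k) \<times> (real^'q), real) dfun" where
  "sigma_comp \<alpha> = (\<lambda>n y. snd (y 0) $ \<alpha>)"

text \<open>A matrix of operators \<open>H\<close> whose coefficients are functions of \<open>\<kappa>\<close> and its shifts,
  without explicit dependence on \<open>n\<close>, as an operator on difference functions of \<open>\<kappa>\<close>.\<close>

definition autonomous ::
  "('k \<Rightarrow> 'q \<Rightarrow> int \<Rightarrow> (int \<Rightarrow> real^'k) \<Rightarrow> real) \<Rightarrow> 'k \<Rightarrow> 'q \<Rightarrow> int \<Rightarrow> (real^'k, real) dfun" where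
  "autonomous H = (\<lambda>\<beta> \<alpha> j n. H \<beta> \<alpha> j)"

definition H_sigma ::
  "int \<Rightarrow> ('k \<Rightarrow> 'q::finite \<Rightarrow> int \<Rightarrow> (int \<Rightarrow> real^'k::finite) \<Rightarrow> real) \<Rightarrow> 'k \<Rightarrow>
   ((real^'k) \<times> (real^'q), real) dfun" where
  "H_sigma p H = dop_matrix p (\<lambda>\<beta> \<alpha> j. on_kappa (autonomous H \<beta> \<alpha> j)) sigma_comp"

definition invariantized_EL ::
  "int \<Rightarrow> ('k \<Rightarrow> 'q::finite \<Rightarrow> int \<Rightarrow> (int \<Rightarrow> real^'k::finite) \<Rightarrow> real) \<Rightarrow> int \<Rightarrow>
   (real^'k, real) dfun \<Rightarrow> 'q \<Rightarrow> (real^'k, real) dfun" where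
  "invariantized_EL p H J1 L = dop_matrix_adjoint p (autonomous H) (euler J1 L)"

definition boundary_term ::
  "int \<Rightarrow> (int \<Rightarrow> 'q::finite \<Rightarrow> (real^'k, real) dfun) \<Rightarrow> ((real^'k) \<times> (real^'q), real) dfun" where
  "boundary_term p C = (\<lambda>n y. \<Sum>j\<in>{- p..p}. \<Sum>\<alpha>\<in>UNIV.
     on_kappa (C j \<alpha>) n y * Shift j (sigma_comp \<alpha>) n y)"

text \<open>\<open>w j\<close> is the curve \<open>t \<mapsto> u\<^sub>j(t)\<close>, for \<open>t\<close> in the open set \<open>I\<close>.\<close>

definition variation :: "(int \<Rightarrow> real^'q::finite) set \<Rightarrow> real set \<Rightarrow> (int \<Rightarrow> real \<Rightarrow> real^'q) \<Rightarrow> bool" where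
  "variation X I w \<longleftrightarrow> open I \<and> (\<forall>j. smooth_on (w j) I) \<and> (\<forall>t\<in>I. (\<lambda>j. w j t) \<in> X)"

text \<open>All the shifts of \<open>\<kappa>\<close> and of \<open>\<sigma> = \<rho>\<^sub>0 \<cdot> (u\<^sub>0)'\<close> along a variation; the
  group element is held fixed while differentiating.\<close>

definition kappa_sigma_seq ::
  "int \<Rightarrow> int \<Rightarrow> ('g \<Rightarrow> real^'q::finite \<Rightarrow> real^'q) \<Rightarrow> ((int \<Rightarrow> real^'q) \<Rightarrow> 'g) \<Rightarrow>
   ((int \<Rightarrow> real^'q) \<Rightarrow> real^'k::finite) \<Rightarrow> (int \<Rightarrow> real \<Rightarrow> real^'q) \<Rightarrow> real \<Rightarrow>
   int \<Rightarrow> (real^'k) \<times> (real^'q)" where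
  "kappa_sigma_seq J0 J act \<rho> \<kappa> w t = (\<lambda>j.
     (kappa_seq J0 J \<kappa> (\<lambda>i. w i t) j,
      vector_derivative (\<lambda>s. act (moving_frame J0 J \<rho> j (\<lambda>i. w i t)) (w j s)) (at t)))"

definition syzygies ::
  "int \<Rightarrow> int \<Rightarrow> (int \<Rightarrow> real^'q::finite) set \<Rightarrow> ('g \<Rightarrow> real^'q \<Rightarrow> real^'q) \<Rightarrow>
   ((int \<Rightarrow> real^'q) \<Rightarrow> 'g) \<Rightarrow> ((int \<Rightarrow> real^'q) \<Rightarrow> real^'k::finite) \<Rightarrow>
   int \<Rightarrow> ('k \<Rightarrow> 'q \<Rightarrow> int \<Rightarrow> (int \<Rightarrow> real^'k) \<Rightarrow> real) \<Rightarrow> bool" where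
  "syzygies J0 J X act \<rho> \<kappa> p H \<longleftrightarrow>
     (\<forall>I w t n. variation X I w \<and> t \<in> I \<longrightarrow>
        ((\<lambda>s. kappa_seq J0 J \<kappa> (\<lambda>i. w i s) 0) has_vector_derivative
           (\<chi> \<beta>. H_sigma p H \<beta> n (kappa_sigma_seq J0 J act \<rho> \<kappa> w t))) (at t))"

text \<open>The identity \<open>E(L) \<cdot> H\<sigma> - (H\<^sup>* E(L)) \<cdot> \<sigma> = (S - id) A\<close> at the
  base point \<open>n\<close>, along all variations.\<close>

definition boundary_identity ::
  "int \<Rightarrow> int \<Rightarrow> (int \<Rightarrow> real^'q::finite) set \<Rightarrow> ('g \<Rightarrow> real^'q \<Rightarrow> real^'q) \<Rightarrow>
   ((int \<Rightarrow> real^'q) \<Rightarrow> 'g) \<Rightarrow> ((int \<Rightarrow> real^'q) \<Rightarrow> real^'k::finite) \<Rightarrow>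
   int \<Rightarrow> ('k \<Rightarrow> 'q \<Rightarrow> int \<Rightarrow> (int \<Rightarrow> real^'k) \<Rightarrow> real) \<Rightarrow> int \<Rightarrow> (real^'k, real) dfun \<Rightarrow>
   (int \<Rightarrow> 'q \<Rightarrow> (real^'k, real) dfun) \<Rightarrow> int \<Rightarrow> bool" where
  "boundary_identity J0 J X act \<rho> \<kappa> p H J1 L C n \<longleftrightarrow>
     (\<forall>I w t. variation X I w \<and> t \<in> I \<longrightarrow>
        (let y = kappa_sigma_seq J0 J act \<rho> \<kappa> w t; A = boundary_term p C in
          (\<Sum>\<beta>\<in>UNIV. on_kappa (euler J1 L \<beta>) n y * H_sigma p H \<beta> n y)
          - (\<Sum>\<alpha>\<in>UNIV. on_kappa (invariantized_EL p H J1 L \<alpha>) n y * sigma_comp \<alpha> n y)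
          = Shift 1 A n y - A n y))"

text \<open>The matrix \<open>\<Phi>\<^sub>0(I) = \<Phi>(\<rho>\<^sub>0 \<cdot> u\<^sub>0)\<close> and the row vector \<open>V(I)\<close>.\<close>

definition Phi0 ::
  "int \<Rightarrow> int \<Rightarrow> (real^'r::finite \<Rightarrow> 'g) \<Rightarrow> ('g \<Rightarrow> real^'q::finite \<Rightarrow> real^'q) \<Rightarrow>
   ((int \<Rightarrow> real^'q) \<Rightarrow> 'g) \<Rightarrow> (real^'q, real^'r^'q) dfun" where
  "Phi0 J0 J \<Gamma> act \<rho> = (\<lambda>n z. characteristics \<Gamma> act (act (moving_frame J0 J \<rho> 0 z) (z 0)))"

definition V_I ::
  "'g monoid \<Rightarrow> int \<Rightarrow> int \<Rightarrow> (real^'r::finite \<Rightarrow> 'g) \<Rightarrow> (real^'q::finite) set \<Rightarrow>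
   ('g \<Rightarrow> real^'q \<Rightarrow> real^'q) \<Rightarrow> ((int \<Rightarrow> real^'q) \<Rightarrow> 'g) \<Rightarrow>
   ((int \<Rightarrow> real^'q) \<Rightarrow> real^'k::finite) \<Rightarrow> int \<Rightarrow> (int \<Rightarrow> 'q \<Rightarrow> (real^'k, real) dfun) \<Rightarrow>
   (real^'q, real^'r) dfun" where
  "V_I G J0 J \<Gamma> U act \<rho> \<kappa> p C = (\<lambda>n z. \<Sum>j\<in>{- p..p}. \<Sum>\<alpha>\<in>UNIV.
     C j \<alpha> n (kappa_seq J0 J \<kappa> z) *\<^sub>R
       (row \<alpha> (Shift j (Phi0 J0 J \<Gamma> act \<rho>) n z) v*
        Ad \<Gamma> U act (moving_frame J0 J \<rho> j z \<otimes>\<^bsub>G\<^esub> inv\<^bsub>G\<^esub> moving_frame J0 J \<rho> 0 z)))"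


section \<open>Intervals of integers and base points\<close>

definition int_interval :: "int set \<Rightarrow> bool" where
  "int_interval N \<longleftrightarrow> (\<forall>a\<in>N. \<forall>b\<in>N. {a..b} \<subseteq> N)"

text \<open>Base points \<open>n\<close> over which the prolongation space with coordinates
  \<open>J0 - M, \<dots>, J + M\<close> only involves points of \<open>N\<close>.\<close>

definition base_points :: "int \<Rightarrow> int \<Rightarrow> int \<Rightarrow> int set \<Rightarrow> int set" where
  "base_points J0 J M N = {n. {n + J0 - M..n + J + M} \<subseteq> N}"

definition shift_seq :: "int \<Rightarrow> (int \<Rightarrow> 'a) \<Rightarrow> (int \<Rightarrow> 'a)" where
  "shift_seq n u = (\<lambda>j. u (n + j))"

end

theory Submission
  imports Defs
begin

text \<open>The conservation law is Noether's theorem read off from a single variation. Let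
  \<open>z = (u\<^sub>n\<^sub>+\<^sub>j)\<close> be the solution seen from the base point \<open>n\<close>, and move all its points in
  the direction of the \<open>r\<close>-th infinitesimal generator, \<open>w\<^sub>j(s) = \<Gamma>(s e\<^sub>r) \<cdot> z\<^sub>j\<close>. The invariants
  \<open>\<kappa>\<close> do not change along this variation, so the syzygies give \<open>H \<sigma> = 0\<close>. On a solution
  \<open>H\<^sup>* E(L) = 0\<close> as well, so the left-hand side of the boundary identity vanishes and
  the boundary term satisfies \<open>S A = A\<close>.

  It remains to recognize this boundary term as the \<open>r\<close>-th entry of \<open>V(I) Ad(\<rho>\<^sub>0)\<close>. The
  \<open>j\<close>-th shift of \<open>\<sigma>\<close> is the image of the generator under the differential of the map
  \<open>u \<mapsto> \<rho>\<^sub>j \<cdot> u\<close>. By the defining property of the adjoint representation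
  (\<open>Ad_intertwines\<close>) it is the \<open>r\<close>-th column of \<open>\<Phi>(\<rho>\<^sub>j \<cdot> z\<^sub>j) Ad(\<rho>\<^sub>j)\<close>, and
  \<open>Ad(\<rho>\<^sub>j) = Ad(\<rho>\<^sub>j \<rho>\<^sub>0\<^sup>-\<^sup>1) Ad(\<rho>\<^sub>0)\<close> (\<open>Ad_mult\<close>); this is \<open>V_I_Ad_component\<close>.
  Seen from \<open>n\<close>, the shifted term \<open>S A\<close> is the same expression at the base point \<open>n + 1\<close>, so
  the row vector takes the same value at neighbouring base points, and base points form an
  interval.

  Two analytic facts stand behind this. The adjoint matrix is given by a definite description, so
  its existence and uniqueness must be shown. Existence comes from differentiating conjugation
  by \<open>g\<close> in the coordinates \<open>\<Gamma>\<close> (\<open>Ad_exists\<close>), uniqueness from the independence of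
  the generators (\<open>Ad_unique\<close>). Also, the curves \<open>w\<^sub>j\<close> have to form an admissible variation:
  smooth of all orders, for which smooth maps must be closed under composition
  (\<open>Ck_on_compose\<close>), and contained in the domain of the frame for small \<open>s\<close>
  (\<open>variation_orbit_variation\<close>).\<close>

section \<open>Calculus of smooth maps\<close>

lemma Ck_on_subset:
  assumes "Ck_on k f S" "S' \<subseteq> S"
  shows "Ck_on k f S'"
  using assms
proof (induction k arbitrary: f)
  case 0
  then show ?case by (auto intro: continuous_on_subset)
next
  case (Suc k)
  then obtain f' where "\<forall>x\<in>S. (f has_derivative f' x) (at x)" "\<forall>v. Ck_on k (\<lambda>x. f' x v) S"
    by auto
  with Suc show ?case
    by (auto intro!: exI[of _ f'])
qed

lemma Ck_on_cong:
  assumes "Ck_on k f S" "open S" "\<And>x. x \<in> S \<Longrightarrow> f x = g x"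
  shows "Ck_on k g S"
proof (cases k)
  case 0
  then show ?thesis using assms by (simp cong: continuous_on_cong)
next
  case (Suc m)
  then obtain f' where f': "\<forall>x\<in>S. (f has_derivative f' x) (at x)" "\<forall>v. Ck_on m (\<lambda>x. f' x v) S"
    using assms by auto
  have "\<forall>x\<in>S. (g has_derivative f' x) (at x)"
    using f'(1) assms(2,3) has_derivative_transform_within_open by blast
  with f'(2) show ?thesis unfolding Suc by auto
qed

text \<open>The definition of \<open>Ck_on\<close> asks for continuity only at the bottom of the recursion; that the
  classes decrease comes from differentiable functions being continuous. The product and chain
  rules need this, since derivatives there are multiplied by the undifferentiated functions.\<close>

lemma Ck_on_lower: "Ck_on (Suc k) f S \<Longrightarrow> Ck_on k f S"
proof (induction k arbitrary: f)
  case 0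
  then show ?case
    by (auto intro!: continuous_at_imp_continuous_on dest: has_derivative_continuous)
next
  case (Suc k)
  then obtain f' where "\<forall>x\<in>S. (f has_derivative f' x) (at x)" "\<forall>v. Ck_on (Suc k) (\<lambda>x. f' x v) S"
    by (metis Ck_on.simps(2))
  with Suc.IH show ?case by (auto intro!: exI[of _ f'])
qed

lemma Ck_on_const: "Ck_on k (\<lambda>x. c) S"
proof (induction k arbitrary: c)
  case (Suc k)
  then show ?case by (auto intro!: exI[of _ "\<lambda>x v. 0"])
qed simp

lemma Ck_on_bounded_linear:
  assumes "bounded_linear h" "Ck_on k f S"
  shows "Ck_on k (\<lambda>x. h (f x)) S"
  using assms(2)
proof (induction k arbitrary: f)
  case 0
  then show ?case using assms(1) by (auto intro: bounded_linear.continuous_on)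
next
  case (Suc k)
  then obtain f' where "\<forall>x\<in>S. (f has_derivative f' x) (at x)" "\<forall>v. Ck_on k (\<lambda>x. f' x v) S"
    by auto
  with Suc.IH show ?case
    by (auto intro!: exI[of _ "\<lambda>x v. h (f' x v)"] bounded_linear.has_derivative[OF assms(1)])
qed

lemma Ck_on_add:
  assumes "Ck_on k f S" "Ck_on k g S"
  shows "Ck_on k (\<lambda>x. f x + g x) S"
  using assms
proof (induction k arbitrary: f g)
  case 0
  then show ?case by (auto intro: continuous_on_add)
next
  case (Suc k)
  then obtain f' g' where "\<forall>x\<in>S. (f has_derivative f' x) (at x)" "\<forall>v. Ck_on k (\<lambda>x. f' x v) S"
    "\<forall>x\<in>S. (g has_derivative g' x) (at x)" "\<forall>v. Ck_on k (\<lambda>x. g' x v) S"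
    by auto
  with Suc.IH show ?case
    by (auto intro!: exI[of _ "\<lambda>x v. f' x v + g' x v"] has_derivative_add)
qed

lemma Ck_on_sum:
  assumes "finite B" "\<And>b. b \<in> B \<Longrightarrow> Ck_on k (f b) S"
  shows "Ck_on k (\<lambda>x. \<Sum>b\<in>B. f b x) S"
  using assms by (induction B rule: finite_induct) (auto intro: Ck_on_const Ck_on_add)

lemma Ck_on_scaleR:
  assumes "Ck_on k f S" "Ck_on k g S"
  shows "Ck_on k (\<lambda>x. f x *\<^sub>R g x) S"
  using assms
proof (induction k arbitrary: f g)
  case 0
  then show ?case by (auto intro: continuous_on_scaleR)
next
  case (Suc k)
  then obtain f' g' where D: "\<forall>x\<in>S. (f has_derivative f' x) (at x)" "\<forall>v. Ck_on k (\<lambda>x. f' x v) S"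
    "\<forall>x\<in>S. (g has_derivative g' x) (at x)" "\<forall>v. Ck_on k (\<lambda>x. g' x v) S"
    by auto
  have "Ck_on k f S" "Ck_on k g S"
    using Suc.prems by (auto dest!: Ck_on_lower simp del: Ck_on.simps)
  then have "Ck_on k (\<lambda>x. f x *\<^sub>R g' x v + f' x v *\<^sub>R g x) S" for v
    using Suc.IH D by (auto intro!: Ck_on_add)
  with D show ?case
    by (auto intro!: exI[of _ "\<lambda>x v. f x *\<^sub>R g' x v + f' x v *\<^sub>R g x"] has_derivative_scaleR)
qed

lemma Ck_on_Pair:
  assumes "Ck_on k f S" "Ck_on k g S"
  shows "Ck_on k (\<lambda>x. (f x, g x)) S"
proof -
  have "Ck_on k (\<lambda>x. (f x, 0) + (0, g x)) S"
    by (intro Ck_on_add Ck_on_bounded_linear[where h = "\<lambda>y. (y, 0)"]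
        Ck_on_bounded_linear[where h = "\<lambda>y. (0, y)"] assms bounded_linear_Pair
        bounded_linear_ident bounded_linear_zero)
  then show ?thesis by simp
qed

text \<open>The recursion in \<open>Ck_on\<close> speaks of directional derivatives \<open>\<lambda>x. f' x v\<close> with a constant
  direction, whereas the chain rule produces \<open>g' (f x)\<close> in the varying direction \<open>f' x v\<close>.
  Expanding that direction in a basis leaves products of scalar functions with derivatives of
  \<open>g\<close> in constant directions, so the induction hypothesis and the product rule apply.\<close>

lemma Ck_on_compose:
  fixes f :: "'a::euclidean_space \<Rightarrow> 'b::euclidean_space"
    and g :: "'b \<Rightarrow> 'c::real_normed_vector"
  assumes "Ck_on k f S" "Ck_on k g S'" "f ` S \<subseteq> S'"
  shows "Ck_on k (\<lambda>x. g (f x)) S"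
  using assms(1,2)
proof (induction k arbitrary: g)
  case 0
  then show ?case using assms(3) by (auto intro: continuous_on_compose2)
next
  case (Suc k)
  then obtain f' g' where D: "\<forall>x\<in>S. (f has_derivative f' x) (at x)" "\<And>v. Ck_on k (\<lambda>x. f' x v) S"
    "\<forall>y\<in>S'. (g has_derivative g' y) (at y)" "\<And>v. Ck_on k (\<lambda>y. g' y v) S'"
    by auto
  define D' where "D' x v = (\<Sum>b\<in>Basis. (f' x v \<bullet> b) *\<^sub>R g' (f x) b)" for x v
  have "((\<lambda>x. g (f x)) has_derivative D' x) (at x)" if "x \<in> S" for x
  proof -
    have g': "(g has_derivative g' (f x)) (at (f x))"
      using D(3) assms(3) that by blast
    then interpret g': linear "g' (f x)" by (rule has_derivative_linear)
    have "D' x v = g' (f x) (f' x v)" for v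
      unfolding D'_def by (metis (no_types, lifting) euclidean_representation g'.scale g'.sum sum.cong)
    then have "D' x = (\<lambda>v. g' (f x) (f' x v))" by auto
    with has_derivative_compose[OF D(1)[rule_format, OF that] g'] show ?thesis by simp
  qed
  moreover have "Ck_on k (\<lambda>x. D' x v) S" for v
    unfolding D'_def
    by (intro Ck_on_sum Ck_on_scaleR Ck_on_bounded_linear[where h = "\<lambda>y. y \<bullet> _"]
        bounded_linear_inner_left D Suc.IH finite_Basis Ck_on_lower[OF Suc.prems(1)])
  ultimately show ?case by auto
qed

lemma smooth_on_cong:
  "smooth_on f S \<Longrightarrow> open S \<Longrightarrow> (\<And>x. x \<in> S \<Longrightarrow> f x = g x) \<Longrightarrow> smooth_on g S"
  unfolding smooth_on_def by (blast intro: Ck_on_cong)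

lemma smooth_on_compose:
  fixes f :: "'a::euclidean_space \<Rightarrow> 'b::euclidean_space"
  shows "smooth_on f S \<Longrightarrow> smooth_on g S' \<Longrightarrow> f ` S \<subseteq> S' \<Longrightarrow> smooth_on (\<lambda>x. g (f x)) S"
  unfolding smooth_on_def by (blast intro: Ck_on_compose)

lemma smooth_on_imp_differentiable:
  assumes "smooth_on f S" "x \<in> S"
  shows "f differentiable at x"
proof -
  have "Ck_on (Suc 0) f S" using assms(1) unfolding smooth_on_def by blast
  with assms(2) show ?thesis by (auto simp: differentiable_def)
qed

lemma smooth_on_scaleR_left:
  fixes v :: "'a::real_normed_vector"
  shows "smooth_on (\<lambda>s::real. s *\<^sub>R v) S"
proof -
  have id: "Ck_on k (\<lambda>s::real. s) S" for k
    by (cases k) (auto intro!: exI[of _ "\<lambda>x v. v"] Ck_on_const has_derivative_ident continuous_on_id)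
  then show ?thesis
    unfolding smooth_on_def
    by (intro allI Ck_on_bounded_linear[where h = "\<lambda>s. s *\<^sub>R v"] bounded_linear_scaleR_left id)
qed

lemma differentiable_at_cong:
  assumes "f differentiable (at a)" "eventually (\<lambda>x. f x = g x) (nhds a)"
  shows "g differentiable (at a)"
proof -
  obtain S where S: "open S" "a \<in> S" "\<And>x. x \<in> S \<Longrightarrow> f x = g x"
    using assms(2) by (auto simp: eventually_nhds)
  obtain f' where "(f has_derivative f') (at a)"
    using assms(1) by (auto simp: differentiable_def)
  then have "(g has_derivative f') (at a)"
    using has_derivative_transform_within_open S by blast
  then show ?thesis by (auto simp: differentiable_def)
qed

lemma differentiable_Pair:
  assumes "f differentiable (at a)" "g differentiable (at a)"
  shows "(\<lambda>x. (f x, g x)) differentiable (at a)"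
proof -
  obtain f' g' where "(f has_derivative f') (at a)" "(g has_derivative g') (at a)"
    using assms by (auto simp: differentiable_def)
  then have "((\<lambda>x. (f x, g x)) has_derivative (\<lambda>h. (f' h, g' h))) (at a)"
    by (rule has_derivative_Pair)
  then show ?thesis by (auto simp: differentiable_def)
qed

lemma matrix_vector_mult_linear:
  fixes f :: "real^'n \<Rightarrow> real^'m"
  assumes "linear f"
  shows "matrix f *v x = f x"
  using assms by (simp add: matrix_works linear_matrix_vector_mul_eq)

lemma matrix_eq_of_has_derivative:
  fixes A B :: "real^'m^'n"
  assumes "(f has_derivative (\<lambda>v. A *v v)) (at x)" "(f has_derivative (\<lambda>v. B *v v)) (at x)"
  shows "A = B"
  using has_derivative_unique[OF assms] by (metis matrix_eq)

section \<open>Differentiable maps into a Lie group\<close>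

lemma chart_inv_into:
  assumes "is_chart T (W, \<phi>)" "g \<in> W"
  shows "inv_into W \<phi> (\<phi> g) = g"
proof -
  have W: "openin T W" "homeomorphic_map (subtopology T W) (top_of_set (\<phi> ` W)) \<phi>"
    using assms(1) by (auto simp: is_chart_def)
  have "topspace (subtopology T W) = W"
    using openin_subset[OF W(1)] by auto
  then have "inj_on \<phi> W"
    using homeomorphic_imp_injective_map[OF W(2)] by simp
  then show ?thesis using assms(2) by simp
qed

context lie_group
begin

text \<open>Differentiability at a point of a map into the group. Continuity is a separate requirement,
  since a chart says nothing about points that are mapped outside its domain. Quantifying over all
  charts around \<open>q a\<close> leaves each application free to choose the chart.\<close>

definition differentiable_into :: "('a::euclidean_space \<Rightarrow> 'g) \<Rightarrow> 'a \<Rightarrow> bool" where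
  "differentiable_into q a \<longleftrightarrow> limitin T q (q a) (nhds a) \<and>
     (\<forall>(W, \<phi>)\<in>\<A>. q a \<in> W \<longrightarrow> (\<lambda>x. \<phi> (q x)) differentiable (at a))"

lemma differentiable_intoI:
  assumes "limitin T q (q a) (nhds a)"
    and "\<And>W \<phi>. (W, \<phi>) \<in> \<A> \<Longrightarrow> q a \<in> W \<Longrightarrow> (\<lambda>x. \<phi> (q x)) differentiable (at a)"
  shows "differentiable_into q a"
  using assms by (auto simp: differentiable_into_def)

lemma chart_at:
  assumes "g \<in> carrier G"
  obtains W \<phi> where "(W, \<phi>) \<in> \<A>" "g \<in> W" "openin T W" "is_chart T (W, \<phi>)"
proof -
  obtain W \<phi> where W: "(W, \<phi>) \<in> \<A>" "g \<in> W"
    using assms unfolding covering[symmetric] by force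
  show ?thesis
    using that[OF W] charts[OF W(1)] by (simp add: is_chart_def)
qed

lemma differentiable_into_carrier: "differentiable_into q a \<Longrightarrow> q a \<in> carrier G"
  unfolding differentiable_into_def limitin_def topspace by blast

lemma differentiable_into_eventually:
  "differentiable_into q a \<Longrightarrow> openin T W \<Longrightarrow> q a \<in> W \<Longrightarrow> eventually (\<lambda>x. q x \<in> W) (nhds a)"
  unfolding differentiable_into_def limitin_def by blast

lemma differentiable_into_const: "g \<in> carrier G \<Longrightarrow> differentiable_into (\<lambda>x. g) a"
  by (auto simp: differentiable_into_def limitin_def topspace)

text \<open>The chain rule for a map into the group followed by a function \<open>f\<close> on the group:
  differentiability of \<open>f\<close> is expressed by its representative \<open>F\<close> in one chart, and continuity
  of \<open>q\<close> ensures that the values near \<open>a\<close> lie in that chart.\<close>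

lemma differentiable_into_transform:
  assumes diff: "differentiable_into q a" and W: "openin T W" "q a \<in> W" "is_chart T (W, \<phi>)"
    and \<phi>: "(\<lambda>x. \<phi> (q x)) differentiable (at a)"
    and F: "F differentiable (at (\<phi> (q a)))"
    and eq: "\<And>g. g \<in> W \<Longrightarrow> F (\<phi> g) = f g"
  shows "(\<lambda>x. f (q x)) differentiable (at a)"
proof -
  have "(\<lambda>x. F (\<phi> (q x))) differentiable (at a)"
    using differentiable_chain_at[OF \<phi> F] by (simp add: o_def)
  then show ?thesis
    by (rule differentiable_at_cong)
      (use differentiable_into_eventually[OF diff W(1,2)] in eventually_elim, rule eq)
qed

lemma differentiable_into_mult:
  fixes q q' :: "'a::euclidean_space \<Rightarrow> 'g"
  assumes q: "differentiable_into q a" and q': "differentiable_into q' a"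
  shows "differentiable_into (\<lambda>x. q x \<otimes> q' x) a"
proof (rule differentiable_intoI)
  have "limitin (prod_topology T T) (\<lambda>x. (q x, q' x)) (q a, q' a) (nhds a)"
    using q q' by (simp add: limitin_pairwise differentiable_into_def o_def)
  from continuous_map_limit[OF continuous_mult this]
  show "limitin T (\<lambda>x. q x \<otimes> q' x) (q a \<otimes> q' a) (nhds a)"
    by (simp add: o_def)
next
  fix V \<psi> assume V: "(V, \<psi>) \<in> \<A>" "q a \<otimes> q' a \<in> V"
  obtain W \<phi> where W: "(W, \<phi>) \<in> \<A>" "q a \<in> W" "openin T W" "is_chart T (W, \<phi>)"
    using chart_at[OF differentiable_into_carrier[OF q]] .
  obtain W' \<phi>' where W': "(W', \<phi>') \<in> \<A>" "q' a \<in> W'" "openin T W'" "is_chart T (W', \<phi>')"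
    using chart_at[OF differentiable_into_carrier[OF q']] .
  define F where "F = (\<lambda>(x, y). \<psi> (inv_into W \<phi> x \<otimes> inv_into W' \<phi>' y))"
  define S where "S = {z \<in> \<phi> ` W \<times> \<phi>' ` W'. inv_into W \<phi> (fst z) \<otimes> inv_into W' \<phi>' (snd z) \<in> V}"
  have "smooth_on F S"
    using smooth_mult[OF W(1) W'(1)] V(1)
    by (auto simp: smooth_into_def F_def S_def o_def case_prod_unfold)
  moreover have "(\<phi> (q a), \<phi>' (q' a)) \<in> S"
    using W(2) W'(2) V(2) by (auto simp: S_def chart_inv_into[OF W(4)] chart_inv_into[OF W'(4)])
  ultimately have "F differentiable (at (\<phi> (q a), \<phi>' (q' a)))"
    by (rule smooth_on_imp_differentiable)
  moreover have "(\<lambda>x. (\<phi> (q x), \<phi>' (q' x))) differentiable (at a)"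
  proof -
    have "(\<lambda>x. \<phi> (q x)) differentiable (at a)" "(\<lambda>x. \<phi>' (q' x)) differentiable (at a)"
      using q q' W(1,2) W'(1,2) by (auto simp: differentiable_into_def)
    then show ?thesis by (rule differentiable_Pair)
  qed
  ultimately have "(\<lambda>x. F (\<phi> (q x), \<phi>' (q' x))) differentiable (at a)"
    using differentiable_chain_at[of "\<lambda>x. (\<phi> (q x), \<phi>' (q' x))" a F] by (simp add: o_def)
  moreover have "eventually (\<lambda>x. F (\<phi> (q x), \<phi>' (q' x)) = \<psi> (q x \<otimes> q' x)) (nhds a)"
    using differentiable_into_eventually[OF q W(3,2)] differentiable_into_eventually[OF q' W'(3,2)]
    by eventually_elim (simp add: F_def chart_inv_into[OF W(4)] chart_inv_into[OF W'(4)])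
  ultimately show "(\<lambda>x. \<psi> (q x \<otimes> q' x)) differentiable (at a)"
    by (rule differentiable_at_cong)
qed

end

section \<open>Parametrization of the group near the identity\<close>

locale parametrized_lie_group = lie_group G T \<A>
  for G :: "'g monoid" (structure) and T :: "'g topology" and \<A> :: "('g, 'r::finite) chart set" +
  fixes \<Omega> :: "(real^'r) set" and \<Gamma> :: "real^'r \<Rightarrow> 'g"
  assumes parametrization: "parametrization_at_one G T \<A> \<Omega> \<Gamma>"
begin

abbreviation "coords \<equiv> inv_into \<Omega> \<Gamma>"

lemma param:
  shows open_domain: "open \<Omega>" and zero_in_domain: "0 \<in> \<Omega>" and \<Gamma>_0: "\<Gamma> 0 = \<one>"
    and inj_\<Gamma>: "inj_on \<Gamma> \<Omega>" and coords_chart: "is_chart T (\<Gamma> ` \<Omega>, coords)"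
    and coords_compatible: "c \<in> \<A> \<Longrightarrow> compatible_charts (\<Gamma> ` \<Omega>, coords) c"
  using parametrization by (auto simp: parametrization_at_one_def)

lemma coords_\<Gamma>: "a \<in> \<Omega> \<Longrightarrow> coords (\<Gamma> a) = a"
  by (simp add: inj_\<Gamma>)

lemma openin_\<Gamma>_image: "openin T (\<Gamma> ` \<Omega>)"
  using coords_chart by (simp add: is_chart_def)

lemma \<Gamma>_carrier: "a \<in> \<Omega> \<Longrightarrow> \<Gamma> a \<in> carrier G"
  using openin_subset[OF openin_\<Gamma>_image] topspace by auto

lemma coords_image: "coords ` (\<Gamma> ` \<Omega> \<inter> W) = {a \<in> \<Omega>. \<Gamma> a \<in> W}"
  by (force simp: coords_\<Gamma>)

text \<open>This is continuity of \<open>\<Gamma>\<close>: \<open>coords\<close>, being a chart, is an open map, and its images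
  are the preimages under \<open>\<Gamma>\<close>.\<close>

lemma open_\<Gamma>_vimage:
  assumes "openin T W"
  shows "open {a \<in> \<Omega>. \<Gamma> a \<in> W}"
proof -
  have "coords ` \<Gamma> ` \<Omega> = \<Omega>"
    using coords_image[of UNIV] by simp
  then have hom: "homeomorphic_map (subtopology T (\<Gamma> ` \<Omega>)) (top_of_set \<Omega>) coords"
    using coords_chart by (simp add: is_chart_def)
  have "openin (subtopology T (\<Gamma> ` \<Omega>)) (\<Gamma> ` \<Omega> \<inter> W)"
    using assms by (simp add: openin_subtopology_Int2)
  with hom have "openin (top_of_set \<Omega>) (coords ` (\<Gamma> ` \<Omega> \<inter> W))"
    by (metis homeomorphic_map_openness openin_subset)
  then show ?thesis
    using open_domain coords_image openin_open_trans by fastforce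
qed

lemma smooth_chart_\<Gamma>:
  assumes "(W, \<phi>) \<in> \<A>"
  shows "smooth_on (\<lambda>a. \<phi> (\<Gamma> a)) {a \<in> \<Omega>. \<Gamma> a \<in> W}"
proof (rule smooth_on_cong)
  show "smooth_on (\<phi> \<circ> inv_into (\<Gamma> ` \<Omega>) coords) {a \<in> \<Omega>. \<Gamma> a \<in> W}"
    using coords_compatible[OF assms] by (simp add: compatible_charts_def coords_image)
  show "open {a \<in> \<Omega>. \<Gamma> a \<in> W}"
    using charts[OF assms] by (auto simp: is_chart_def intro: open_\<Gamma>_vimage)
  fix a assume "a \<in> {a \<in> \<Omega>. \<Gamma> a \<in> W}"
  then show "(\<phi> \<circ> inv_into (\<Gamma> ` \<Omega>) coords) a = \<phi> (\<Gamma> a)"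
    using chart_inv_into[OF coords_chart, of "\<Gamma> a"] by (simp add: coords_\<Gamma>)
qed

lemma differentiable_into_\<Gamma>: "differentiable_into \<Gamma> 0"
proof (rule differentiable_intoI)
  show "limitin T \<Gamma> (\<Gamma> 0) (nhds 0)"
    unfolding limitin_def
  proof (intro conjI allI impI)
    show "\<Gamma> 0 \<in> topspace T" by (simp add: \<Gamma>_0 topspace)
    fix W assume W: "openin T W \<and> \<Gamma> 0 \<in> W"
    then show "\<forall>\<^sub>F a in nhds 0. \<Gamma> a \<in> W"
      unfolding eventually_nhds using open_\<Gamma>_vimage[of W] zero_in_domain by blast
  qed
next
  fix W \<phi> assume "(W, \<phi>) \<in> \<A>" "\<Gamma> 0 \<in> W"
  then show "(\<lambda>a. \<phi> (\<Gamma> a)) differentiable (at 0)"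
    using smooth_on_imp_differentiable[OF smooth_chart_\<Gamma>] zero_in_domain by simp
qed

lemma differentiable_coords:
  fixes q :: "'a::euclidean_space \<Rightarrow> 'g"
  assumes q: "differentiable_into q a" "q a \<in> \<Gamma> ` \<Omega>"
  shows "(\<lambda>x. coords (q x)) differentiable (at a)"
proof -
  obtain W \<phi> where W: "(W, \<phi>) \<in> \<A>" "q a \<in> W" "openin T W" "is_chart T (W, \<phi>)"
    using chart_at[OF differentiable_into_carrier[OF q(1)]] .
  have "smooth_on (coords \<circ> inv_into W \<phi>) (\<phi> ` (\<Gamma> ` \<Omega> \<inter> W))"
    using coords_compatible[OF W(1)] by (simp add: compatible_charts_def)
  then have "(coords \<circ> inv_into W \<phi>) differentiable (at (\<phi> (q a)))"
    using smooth_on_imp_differentiable q(2) W(2) by blast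
  moreover have "(\<lambda>x. \<phi> (q x)) differentiable (at a)"
    using q(1) W(1,2) by (auto simp: differentiable_into_def)
  ultimately show ?thesis
    using differentiable_into_transform[OF q(1) W(3,2,4), of "coords \<circ> inv_into W \<phi>" coords]
    by (simp add: chart_inv_into[OF W(4)])
qed

end

section \<open>Smooth actions\<close>

locale smooth_lie_action = parametrized_lie_group G T \<A> \<Omega> \<Gamma>
  for G :: "'g monoid" (structure) and T :: "'g topology" and \<A> :: "('g, 'r::finite) chart set"
    and \<Omega> :: "(real^'r) set" and \<Gamma> :: "real^'r \<Rightarrow> 'g" +
  fixes U :: "(real^'q::finite) set" and act :: "'g \<Rightarrow> real^'q \<Rightarrow> real^'q"
  assumes open_U: "open U"
    and smooth: "smooth_action G \<A> U act"
begin

sublocale group_action G U act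
  using smooth by (simp add: smooth_action_def)

lemma act_closed: "g \<in> carrier G \<Longrightarrow> u \<in> U \<Longrightarrow> act g u \<in> U"
  using element_image by blast

lemma act_one: "u \<in> U \<Longrightarrow> act \<one> u = u"
  by (metis id_eq_one restrict_apply')

lemma act_mult: "g \<in> carrier G \<Longrightarrow> h \<in> carrier G \<Longrightarrow> u \<in> U \<Longrightarrow> act (g \<otimes> h) u = act g (act h u)"
  by (simp add: composition_rule)

lemma act_inv: "g \<in> carrier G \<Longrightarrow> u \<in> U \<Longrightarrow> act g (act (inv g) u) = u"
  using act_mult[of g "inv g" u] by (simp add: act_one)

lemma smooth_act_chart:
  "(W, \<phi>) \<in> \<A> \<Longrightarrow> smooth_on (\<lambda>(x, u). act (inv_into W \<phi> x) u) (\<phi> ` W \<times> U)"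
  using smooth by (auto simp: smooth_action_def)

lemma differentiable_act_chart:
  assumes "(W, \<phi>) \<in> \<A>" "g \<in> W" "u \<in> U"
  shows "(\<lambda>(x, u). act (inv_into W \<phi> x) u) differentiable (at (\<phi> g, u))"
  using smooth_on_imp_differentiable[OF smooth_act_chart[OF assms(1)]] assms(2,3) by blast

lemma differentiable_act:
  assumes "g \<in> carrier G" "u \<in> U"
  shows "act g differentiable (at u)"
proof -
  obtain W \<phi> where W: "(W, \<phi>) \<in> \<A>" "g \<in> W" "openin T W" "is_chart T (W, \<phi>)"
    using chart_at[OF assms(1)] .
  have "(\<lambda>v. (\<phi> g, v)) differentiable (at u)"
    by (intro differentiable_Pair differentiable_const differentiable_ident)
  from differentiable_chain_at[OF this differentiable_act_chart[OF W(1,2) assms(2)]]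
  show ?thesis by (simp add: o_def chart_inv_into[OF W(4,2)])
qed

lemma differentiable_orbit_map:
  fixes q :: "'a::euclidean_space \<Rightarrow> 'g"
  assumes q: "differentiable_into q a" and u: "u \<in> U"
  shows "(\<lambda>x. act (q x) u) differentiable (at a)"
proof -
  obtain W \<phi> where W: "(W, \<phi>) \<in> \<A>" "q a \<in> W" "openin T W" "is_chart T (W, \<phi>)"
    using chart_at[OF differentiable_into_carrier[OF q]] .
  have "(\<lambda>x. (x, u)) differentiable (at (\<phi> (q a)))"
    by (intro differentiable_Pair differentiable_const differentiable_ident)
  from differentiable_chain_at[OF this differentiable_act_chart[OF W(1,2) u]]
  have F: "(\<lambda>x. act (inv_into W \<phi> x) u) differentiable (at (\<phi> (q a)))"
    by (simp add: o_def)
  have \<phi>: "(\<lambda>x. \<phi> (q x)) differentiable (at a)"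
    using q W(1,2) by (auto simp: differentiable_into_def)
  show ?thesis
    by (rule differentiable_into_transform[OF q W(3,2,4) \<phi> F]) (simp add: chart_inv_into[OF W(4)])
qed

text \<open>The characteristics are defined by the partial derivatives along the axes only. Because the
  orbit map is totally differentiable, they make up its Jacobian matrix, which is what the chain rule
  needs.\<close>

lemma has_derivative_orbit_map:
  assumes "u \<in> U"
  shows "((\<lambda>a. act (\<Gamma> a) u) has_derivative (\<lambda>v. characteristics \<Gamma> act u *v v)) (at 0)"
proof -
  obtain F where F: "((\<lambda>a. act (\<Gamma> a) u) has_derivative F) (at 0)"
    using differentiable_orbit_map[OF differentiable_into_\<Gamma> assms] by (auto simp: differentiable_def)
  then interpret F: linear F by (rule has_derivative_linear)
  have column: "vector_derivative (\<lambda>s. act (\<Gamma> (s *\<^sub>R axis r 1)) u) (at 0) = F (axis r 1)" for r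
  proof (rule vector_derivative_at)
    have "((\<lambda>s::real. s *\<^sub>R axis r (1::real)) has_derivative (\<lambda>s. s *\<^sub>R axis r 1)) (at 0)"
      by (auto intro!: derivative_eq_intros)
    from has_derivative_compose[OF this, of "\<lambda>a. act (\<Gamma> a) u" F] F
    show "((\<lambda>s. act (\<Gamma> (s *\<^sub>R axis r 1)) u) has_vector_derivative F (axis r 1)) (at 0)"
      by (simp add: has_vector_derivative_def F.scale)
  qed
  have "characteristics \<Gamma> act u = matrix F"
    by (simp add: characteristics_def matrix_def column vec_eq_iff)
  then show ?thesis
    using F matrix_vector_mult_linear[OF F.linear_axioms] by simp
qed

definition differential :: "'g \<Rightarrow> real^'q \<Rightarrow> real^'q^'q" where
  "differential g u = matrix (frechet_derivative (act g) (at u))"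

lemma has_derivative_act:
  assumes "g \<in> carrier G" "u \<in> U"
  shows "(act g has_derivative (\<lambda>v. differential g u *v v)) (at u)"
proof -
  have D: "(act g has_derivative frechet_derivative (act g) (at u)) (at u)"
    using differentiable_act[OF assms] frechet_derivative_works by blast
  from matrix_vector_mult_linear[OF has_derivative_linear[OF this]]
  have "frechet_derivative (act g) (at u) = (\<lambda>v. differential g u *v v)"
    by (auto simp: differential_def)
  with D show ?thesis by simp
qed

lemma differential_mult:
  assumes "g \<in> carrier G" "h \<in> carrier G" "u \<in> U"
  shows "differential (g \<otimes> h) u = differential g (act h u) ** differential h u"
proof (rule matrix_eq_of_has_derivative)
  show "(act (g \<otimes> h) has_derivative (\<lambda>v. differential (g \<otimes> h) u *v v)) (at u)"
    using assms by (intro has_derivative_act) auto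
  have "((\<lambda>v. act g (act h v)) has_derivative
      (\<lambda>v. differential g (act h u) *v (differential h u *v v))) (at u)"
    using has_derivative_compose[OF has_derivative_act has_derivative_act] assms act_closed by blast
  then show "(act (g \<otimes> h) has_derivative
      (\<lambda>v. (differential g (act h u) ** differential h u) *v v)) (at u)"
    unfolding matrix_vector_mul_assoc[symmetric]
    by (rule has_derivative_transform_within_open[OF _ open_U assms(3)])
      (simp add: act_mult assms)
qed

section \<open>The adjoint representation\<close>

text \<open>Writing \<open>g \<Gamma>(a) g\<^sup>-\<^sup>1 = \<Gamma>(b(a))\<close> near the identity turns
  \<open>g \<cdot> \<Gamma>(a) \<cdot> u\<close> into \<open>\<Gamma>(b(a)) \<cdot> (g \<cdot> u)\<close>. Differentiating both expressions at
  \<open>a = 0\<close> gives the required equation, with the Jacobian of \<open>b\<close> as the matrix; it is the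
  same for all \<open>u\<close>.\<close>

lemma Ad_exists:
  assumes g: "g \<in> carrier G"
  shows "\<exists>M. \<forall>u\<in>U. differential g u ** characteristics \<Gamma> act u = characteristics \<Gamma> act (act g u) ** M"
proof -
  define q where "q a = g \<otimes> \<Gamma> a \<otimes> inv g" for a
  have q: "differentiable_into q 0"
    unfolding q_def using g
    by (intro differentiable_into_mult differentiable_into_const differentiable_into_\<Gamma>) auto
  have q0: "q 0 = \<one>"
    using g by (simp add: q_def \<Gamma>_0)
  then have q_image: "q 0 \<in> \<Gamma> ` \<Omega>"
    using zero_in_domain \<Gamma>_0 by force
  obtain B where B: "((\<lambda>a. coords (q a)) has_derivative B) (at 0)"
    using differentiable_coords[OF q q_image] by (auto simp: differentiable_def)
  have coords0: "coords (q 0) = 0"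
    using coords_\<Gamma>[OF zero_in_domain] by (simp add: q0 \<Gamma>_0)
  have near: "eventually (\<lambda>a. a \<in> \<Omega> \<and> q a \<in> \<Gamma> ` \<Omega>) (nhds 0)"
    using differentiable_into_eventually[OF q openin_\<Gamma>_image q_image]
      eventually_nhds_in_open[OF open_domain zero_in_domain] by eventually_elim simp
  then obtain S where S: "open S" "0 \<in> S" "\<And>a. a \<in> S \<Longrightarrow> a \<in> \<Omega> \<and> q a \<in> \<Gamma> ` \<Omega>"
    by (auto simp: eventually_nhds)
  have "differential g u ** characteristics \<Gamma> act u = characteristics \<Gamma> act (act g u) ** matrix B"
    if u: "u \<in> U" for u
  proof (rule matrix_eq_of_has_derivative)
    have "(act g has_derivative (\<lambda>v. differential g u *v v)) (at (act (\<Gamma> 0) u))"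
      using has_derivative_act[OF g u] by (simp add: \<Gamma>_0 act_one u)
    from has_derivative_compose[OF has_derivative_orbit_map[OF u] this]
    show "((\<lambda>a. act g (act (\<Gamma> a) u)) has_derivative
        (\<lambda>v. (differential g u ** characteristics \<Gamma> act u) *v v)) (at 0)"
      by (simp add: matrix_vector_mul_assoc)
    have "((\<lambda>a. act (\<Gamma> a) (act g u)) has_derivative (\<lambda>v. characteristics \<Gamma> act (act g u) *v v))
        (at (coords (q 0)))"
      unfolding coords0 using has_derivative_orbit_map act_closed[OF g u] by blast
    from has_derivative_compose[OF B this]
    have "((\<lambda>a. act (\<Gamma> (coords (q a))) (act g u)) has_derivative
        (\<lambda>v. (characteristics \<Gamma> act (act g u) ** matrix B) *v v)) (at 0)"
      by (simp add: matrix_vector_mul_assoc[symmetric] matrix_vector_mult_linear[OF has_derivative_linear[OF B]])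
    then show "((\<lambda>a. act g (act (\<Gamma> a) u)) has_derivative
        (\<lambda>v. (characteristics \<Gamma> act (act g u) ** matrix B) *v v)) (at 0)"
    proof (rule has_derivative_transform_within_open[OF _ S(1,2)])
      fix a assume "a \<in> S"
      with S(3) have a: "\<Gamma> a \<in> carrier G" "\<Gamma> (coords (q a)) = q a"
        by (auto simp: \<Gamma>_carrier f_inv_into_f)
      have "act (q a) (act g u) = act (g \<otimes> \<Gamma> a \<otimes> inv g \<otimes> g) u"
        unfolding q_def using g a(1) u by (simp add: act_mult)
      also have "\<dots> = act g (act (\<Gamma> a) u)"
        using g a(1) u by (simp add: m_assoc act_mult)
      finally show "act (\<Gamma> (coords (q a))) (act g u) = act g (act (\<Gamma> a) u)"
        using a(2) by simp
    qed
  qed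
  then show ?thesis by blast
qed

end

locale independent_lie_action = smooth_lie_action +
  assumes independent: "independent_generators \<Gamma> U act"
begin

lemma characteristics_cancel:
  fixes A B :: "real^'b^'b"
  assumes "\<And>u. u \<in> U \<Longrightarrow> characteristics \<Gamma> act u ** A = characteristics \<Gamma> act u ** B"
  shows "A = B"
proof -
  have "A *v x - B *v x = 0" for x
  proof -
    have "\<forall>u\<in>U. characteristics \<Gamma> act u *v (A *v x - B *v x) = 0"
      using assms by (simp add: matrix_vector_mult_diff_distrib matrix_vector_mul_assoc)
    then show ?thesis
      using independent unfolding independent_generators_def by blast
  qed
  then show ?thesis by (simp add: matrix_eq)
qed

text \<open>Every point of \<open>U\<close> is of the form \<open>g \<cdot> u\<close>, so two candidates for the adjoint matrix differ
  by a matrix that is annihilated by the characteristics everywhere; linear independence of the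
  generators makes it zero.\<close>

lemma Ad_unique:
  assumes g: "g \<in> carrier G"
    and M: "\<And>u. u \<in> U \<Longrightarrow>
      differential g u ** characteristics \<Gamma> act u = characteristics \<Gamma> act (act g u) ** M"
  shows "Ad \<Gamma> U act g = M"
  unfolding Ad_def differential_def[symmetric]
proof (rule the_equality)
  show "\<forall>u\<in>U. differential g u ** characteristics \<Gamma> act u = characteristics \<Gamma> act (act g u) ** M"
    using M by blast
  fix M' assume M': "\<forall>u\<in>U. differential g u ** characteristics \<Gamma> act u
    = characteristics \<Gamma> act (act g u) ** M'"
  show "M' = M"
  proof (rule characteristics_cancel)
    fix u assume "u \<in> U"
    then have "act (inv g) u \<in> U" "act g (act (inv g) u) = u"
      using g by (auto simp: act_closed act_inv)
    then show "characteristics \<Gamma> act u ** M' = characteristics \<Gamma> act u ** M"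
      using M M' by metis
  qed
qed

lemma Ad_intertwines:
  assumes "g \<in> carrier G" "u \<in> U"
  shows "differential g u ** characteristics \<Gamma> act u
    = characteristics \<Gamma> act (act g u) ** Ad \<Gamma> U act g"
  using Ad_exists[OF assms(1)] Ad_unique[OF assms(1)] assms(2) by metis

lemma Ad_mult:
  assumes "g \<in> carrier G" "h \<in> carrier G"
  shows "Ad \<Gamma> U act (g \<otimes> h) = Ad \<Gamma> U act g ** Ad \<Gamma> U act h"
proof (rule Ad_unique)
  show "g \<otimes> h \<in> carrier G" using assms by simp
  fix u assume u: "u \<in> U"
  have "differential (g \<otimes> h) u ** characteristics \<Gamma> act u
      = differential g (act h u) ** (characteristics \<Gamma> act (act h u) ** Ad \<Gamma> U act h)"
    using assms u by (simp add: differential_mult Ad_intertwines matrix_mul_assoc[symmetric])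
  also have "\<dots> = characteristics \<Gamma> act (act g (act h u)) ** Ad \<Gamma> U act g ** Ad \<Gamma> U act h"
    using assms u by (simp add: matrix_mul_assoc Ad_intertwines act_closed)
  finally show "differential (g \<otimes> h) u ** characteristics \<Gamma> act u
      = characteristics \<Gamma> act (act (g \<otimes> h) u) ** (Ad \<Gamma> U act g ** Ad \<Gamma> U act h)"
    using assms u by (simp add: act_mult matrix_mul_assoc)
qed

text \<open>With \<open>g = \<rho>\<^sub>j\<close> this evaluates the shift of \<open>\<sigma>\<close> along the curve \<open>\<Gamma>(s e\<^sub>r) \<cdot> u\<close>: pushing
  a generator forward by \<open>g\<close> gives the combination of generators at \<open>g \<cdot> u\<close> that
  \<open>Ad g\<close> prescribes.\<close>

lemma has_vector_derivative_invariantized_generator: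
  assumes "g \<in> carrier G" "u \<in> U"
  shows "((\<lambda>s. act g (act (\<Gamma> (s *\<^sub>R axis r 1)) u)) has_vector_derivative
    column r (characteristics \<Gamma> act (act g u) ** Ad \<Gamma> U act g)) (at 0)"
proof -
  have "((\<lambda>s::real. s *\<^sub>R axis r (1::real)) has_derivative (\<lambda>s. s *\<^sub>R axis r 1)) (at 0)"
    by (auto intro!: derivative_eq_intros)
  from has_derivative_compose[OF this, of "\<lambda>a. act (\<Gamma> a) u"]
  have "((\<lambda>s. act (\<Gamma> (s *\<^sub>R axis r 1)) u) has_derivative
      (\<lambda>s. characteristics \<Gamma> act u *v (s *\<^sub>R axis r 1))) (at 0)"
    using has_derivative_orbit_map[OF assms(2)] by simp
  from has_derivative_compose[OF this, of "act g" "\<lambda>v. differential g u *v v"]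
  have "((\<lambda>s. act g (act (\<Gamma> (s *\<^sub>R axis r 1)) u)) has_derivative
      (\<lambda>s. differential g u *v (characteristics \<Gamma> act u *v (s *\<^sub>R axis r 1)))) (at 0)"
    using has_derivative_act[OF assms] by (simp add: \<Gamma>_0 act_one assms(2))
  moreover have "differential g u *v (characteristics \<Gamma> act u *v (s *\<^sub>R axis r 1))
      = s *\<^sub>R column r (characteristics \<Gamma> act (act g u) ** Ad \<Gamma> U act g)" for s
    unfolding matrix_vector_mul_assoc Ad_intertwines[OF assms]
    by (simp add: matrix_vector_mult_scaleR matrix_vector_mult_basis)
  ultimately show ?thesis by (simp add: has_vector_derivative_def)
qed

end

section \<open>Variations along the orbits\<close>

context smooth_lie_action
begin

text \<open>One interval \<open>I\<close> has to serve all points \<open>u\<close>, since the curves through the different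
  \<open>u\<^sub>j\<close> together form one variation. It only depends on a chart of the group at the identity.\<close>

lemma smooth_orbit_curves:
  obtains I :: "real set" where "open I" "0 \<in> I" "\<And>s. s \<in> I \<Longrightarrow> s *\<^sub>R v \<in> \<Omega>"
    "\<And>u. u \<in> U \<Longrightarrow> smooth_on (\<lambda>s. act (\<Gamma> (s *\<^sub>R v)) u) I"
proof -
  obtain W \<phi> where W: "(W, \<phi>) \<in> \<A>" "\<one> \<in> W" "openin T W" "is_chart T (W, \<phi>)"
    using chart_at[OF one_closed] .
  define O1 where "O1 = {a \<in> \<Omega>. \<Gamma> a \<in> W}"
  define I where "I = (\<lambda>s::real. s *\<^sub>R v) -` O1"
  have "open O1" unfolding O1_def by (rule open_\<Gamma>_vimage[OF W(3)])
  then have I: "open I"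
    unfolding I_def by (intro open_vimage) (auto intro: continuous_intros)
  have smooth: "smooth_on (\<lambda>s. act (\<Gamma> (s *\<^sub>R v)) u) I" if u: "u \<in> U" for u
  proof (rule smooth_on_cong[OF _ I])
    have "smooth_on (\<lambda>s. \<phi> (\<Gamma> (s *\<^sub>R v))) I"
      by (rule smooth_on_compose[OF smooth_on_scaleR_left smooth_chart_\<Gamma>[OF W(1)]])
        (auto simp: I_def O1_def)
    then have "smooth_on (\<lambda>s. (\<phi> (\<Gamma> (s *\<^sub>R v)), u)) I"
      unfolding smooth_on_def by (intro allI Ck_on_Pair Ck_on_const) blast
    then show "smooth_on (\<lambda>s. (\<lambda>(x, u). act (inv_into W \<phi> x) u) (\<phi> (\<Gamma> (s *\<^sub>R v)), u)) I"
      by (rule smooth_on_compose[OF _ smooth_act_chart[OF W(1)]]) (use u in \<open>auto simp: I_def O1_def\<close>)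
    fix s assume "s \<in> I"
    then show "(\<lambda>(x, u). act (inv_into W \<phi> x) u) (\<phi> (\<Gamma> (s *\<^sub>R v)), u) = act (\<Gamma> (s *\<^sub>R v)) u"
      by (simp add: I_def O1_def chart_inv_into[OF W(4)])
  qed
  have "0 \<in> I" "\<And>s. s \<in> I \<Longrightarrow> s *\<^sub>R v \<in> \<Omega>"
    using zero_in_domain W(2) by (simp_all add: I_def O1_def \<Gamma>_0)
  from that[OF I this smooth] show ?thesis .
qed

lemma admissible_in_U:
  assumes D: "D \<subseteq> prolong J0 J U" and z: "z \<in> admissible J0 J D a b"
    and "J0 \<le> J" "a \<le> b" and j: "j \<in> {J0 + a..J + b}"
  shows "z j \<in> U"
proof -
  define k where "k = max a (j - J)"
  have k: "k \<in> {a..b}" "j - k \<in> {J0..J}"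
    using assms by (auto simp: k_def)
  have "window J0 J k z \<in> prolong J0 J U"
    using k(1) z D by (auto simp: admissible_def)
  then have "window J0 J k z (j - k) \<in> U"
    using k(2) unfolding prolong_def by blast
  with k(2) show ?thesis by (simp add: window_def)
qed

text \<open>Only the points \<open>z j\<close> in the range of the prolongation space are known to lie in \<open>U\<close>,
  where the action is defined and smooth. Keeping the remaining points fixed makes every
  component a smooth curve.\<close>

definition orbit_variation :: "int set \<Rightarrow> real^'r \<Rightarrow> (int \<Rightarrow> real^'q) \<Rightarrow> int \<Rightarrow> real \<Rightarrow> real^'q" where
  "orbit_variation B v z j s = (if j \<in> B then act (\<Gamma> (s *\<^sub>R v)) (z j) else z j)"

lemma window_orbit_variation:
  assumes "k \<in> {a..b}"
  shows "window J0 J k (\<lambda>j. orbit_variation {J0 + a..J + b} v z j s)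
    = window J0 J k (\<lambda>j. act (\<Gamma> (s *\<^sub>R v)) (z j))"
  using assms by (auto simp: window_def orbit_variation_def)

lemma orbit_variation_0:
  assumes "\<And>j. j \<in> B \<Longrightarrow> z j \<in> U"
  shows "(\<lambda>j. orbit_variation B v z j 0) = z"
  using assms by (auto simp: orbit_variation_def \<Gamma>_0 act_one)

text \<open>The domain \<open>D\<close> need not be invariant, but it is open, so a short piece of the orbit through
  each of the finitely many windows of \<open>z\<close> stays inside.\<close>

lemma variation_orbit_variation:
  assumes D: "openin (top_of_set (prolong J0 J U)) D" and z: "z \<in> admissible J0 J D a b"
    and le: "J0 \<le> J" "a \<le> b"
  obtains I where "0 \<in> I" "\<And>s. s \<in> I \<Longrightarrow> s *\<^sub>R v \<in> \<Omega>"
    "variation (admissible J0 J D a b) I (orbit_variation {J0 + a..J + b} v z)"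
proof -
  let ?B = "{J0 + a..J + b}"
  let ?w = "orbit_variation ?B v z"
  obtain I1 :: "real set" where I1: "open I1" "0 \<in> I1" "\<And>s. s \<in> I1 \<Longrightarrow> s *\<^sub>R v \<in> \<Omega>"
    "\<And>u. u \<in> U \<Longrightarrow> smooth_on (\<lambda>s. act (\<Gamma> (s *\<^sub>R v)) u) I1"
    by (rule smooth_orbit_curves[of v]) blast
  have zU: "z j \<in> U" if "j \<in> ?B" for j
    using admissible_in_U[OF openin_imp_subset[OF D] z le that] .
  have smooth_w: "smooth_on (?w j) I" if "I \<subseteq> I1" for I j
  proof (cases "j \<in> ?B")
    case True
    then have "?w j = (\<lambda>s. act (\<Gamma> (s *\<^sub>R v)) (z j))"
      by (auto simp: orbit_variation_def)
    then show ?thesis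
      using I1(4)[OF zU[OF True]] that unfolding smooth_on_def by (metis Ck_on_subset)
  next
    case False
    then have "?w j = (\<lambda>s. z j)"
      by (auto simp: orbit_variation_def)
    then show ?thesis
      by (simp add: smooth_on_def Ck_on_const)
  qed
  obtain V where V: "open V" "D = prolong J0 J U \<inter> V"
    using D by (auto simp: openin_open)
  define I where "I = (\<Inter>k\<in>{a..b}. {s \<in> I1. window J0 J k (\<lambda>j. ?w j s) \<in> V})"
  have "open {s \<in> I1. window J0 J k (\<lambda>j. ?w j s) \<in> V}" for k
  proof -
    have "continuous_on I1 (?w j)" for j
      using smooth_w[OF subset_refl, of j] unfolding smooth_on_def by (metis Ck_on.simps(1))
    then have "continuous_on I1 (\<lambda>s. window J0 J k (\<lambda>j. ?w j s) i)" for i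
      by (cases "i \<in> {J0..J}") (auto simp: window_def restrict_def)
    then have "continuous_on I1 (\<lambda>s. window J0 J k (\<lambda>j. ?w j s))"
      by (rule continuous_on_coordinatewise_then_product)
    from continuous_open_preimage[OF this I1(1) V(1)] show ?thesis
      by (simp add: vimage_def Int_def)
  qed
  then have "open I" unfolding I_def by (intro open_INT) auto
  have "I \<subseteq> {s \<in> I1. window J0 J a (\<lambda>j. ?w j s) \<in> V}"
    unfolding I_def using le(2) by (intro INT_lower) simp
  then have I_sub: "I \<subseteq> I1" by blast
  have admissible_w: "(\<lambda>j. ?w j s) \<in> admissible J0 J D a b" if s: "s \<in> I" for s
  proof -
    have "window J0 J k (\<lambda>j. ?w j s) \<in> D" if k: "k \<in> {a..b}" for k
    proof -
      have "act (\<Gamma> (s *\<^sub>R v)) (z (j + k)) \<in> U" if "j \<in> {J0..J}" for j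
        using that k s I_sub by (intro act_closed \<Gamma>_carrier I1(3) zU) auto
      then have "window J0 J k (\<lambda>j. ?w j s) \<in> prolong J0 J U"
        unfolding window_orbit_variation[OF k] by (simp add: prolong_def window_def)
      moreover have "window J0 J k (\<lambda>j. ?w j s) \<in> V"
        using s k by (simp add: I_def)
      ultimately show ?thesis using V(2) by blast
    qed
    then show ?thesis by (simp add: admissible_def)
  qed
  have w0: "(\<lambda>j. ?w j 0) = z"
    by (rule orbit_variation_0[OF zU])
  have "window J0 J k z \<in> V" if "k \<in> {a..b}" for k
    using z that V(2) unfolding admissible_def by blast
  then have zero: "0 \<in> I"
    unfolding I_def INT_iff mem_Collect_eq w0 using I1(2) by blast
  have domain: "s *\<^sub>R v \<in> \<Omega>" if "s \<in> I" for s
    using that I1(3) I_sub by blast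
  have "variation (admissible J0 J D a b) I ?w"
    using \<open>open I\<close> smooth_w[OF I_sub] admissible_w by (simp add: variation_def)
  from that[OF zero domain this] show ?thesis .
qed

lemma kappa_seq_orbit_variation:
  assumes inv: "invariant_under G act (\<lambda>z. \<kappa> (window J0 J 0 z)) (admissible J0 J D 0 0)"
    and z: "z \<in> admissible J0 J D a b"
    and w: "(\<lambda>j. orbit_variation {J0 + a..J + b} v z j s) \<in> admissible J0 J D a b"
    and s: "s *\<^sub>R v \<in> \<Omega>" and k: "0 \<in> {a..b}"
  shows "kappa_seq J0 J \<kappa> (\<lambda>j. orbit_variation {J0 + a..J + b} v z j s) 0 = kappa_seq J0 J \<kappa> z 0"
proof -
  have "window J0 J 0 (\<lambda>j. act (\<Gamma> (s *\<^sub>R v)) (z j)) \<in> D"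
    using w k unfolding window_orbit_variation[OF k, symmetric] by (simp add: admissible_def)
  then have "(\<lambda>j. act (\<Gamma> (s *\<^sub>R v)) (z j)) \<in> admissible J0 J D 0 0" "z \<in> admissible J0 J D 0 0"
    using z k by (auto simp: admissible_def)
  with inv \<Gamma>_carrier[OF s] show ?thesis
    unfolding kappa_seq_def window_orbit_variation[OF k] by (simp add: invariant_under_def)
qed

end

section \<open>The conservation law\<close>

context independent_lie_action
begin

text \<open>Multiplicativity of the adjoint representation merges \<open>Ad (\<rho>\<^sub>j \<rho>\<^sub>0\<^sup>-\<^sup>1)\<close> with
  \<open>Ad \<rho>\<^sub>0\<close>. What remains is the boundary term with \<open>S\<^sub>j \<sigma>\<close> replaced by the
  \<open>r\<close>-th column of \<open>\<Phi>(\<rho>\<^sub>j \<cdot> u\<^sub>j) Ad(\<rho>\<^sub>j)\<close>, that is, by its value along the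
  variation in the direction of the \<open>r\<close>-th generator.\<close>

lemma V_I_Ad_component:
  assumes "0 \<in> {- p..p}"
    and "\<And>j. j \<in> {- p..p} \<Longrightarrow> moving_frame J0 J \<rho> j z \<in> carrier G"
  shows "(V_I G J0 J \<Gamma> U act \<rho> \<kappa> p C n z v* Ad \<Gamma> U act (moving_frame J0 J \<rho> 0 z)) $ r
    = (\<Sum>j\<in>{- p..p}. \<Sum>\<alpha>\<in>UNIV. C j \<alpha> n (kappa_seq J0 J \<kappa> z) *
        column r (characteristics \<Gamma> act (act (moving_frame J0 J \<rho> j z) (z j))
          ** Ad \<Gamma> U act (moving_frame J0 J \<rho> j z)) $ \<alpha>)"
proof -
  let ?\<rho> = "\<lambda>j. moving_frame J0 J \<rho> j z"
  let ?Ad = "Ad \<Gamma> U act"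
  let ?\<Phi> = "\<lambda>j. characteristics \<Gamma> act (act (?\<rho> j) (z j))"
  have shift: "Shift j (Phi0 J0 J \<Gamma> act \<rho>) n z = ?\<Phi> j" for j
    by (simp add: Shift_def Phi0_def moving_frame_def window_def)
  have Ad_split: "?Ad (?\<rho> j \<otimes> inv ?\<rho> 0) ** ?Ad (?\<rho> 0) = ?Ad (?\<rho> j)" if "j \<in> {- p..p}" for j
    using Ad_mult[of "?\<rho> j \<otimes> inv ?\<rho> 0" "?\<rho> 0"] assms that by (simp add: m_assoc)
  have row: "(row \<alpha> (?\<Phi> j) v* A v* B) $ r = column r (?\<Phi> j ** (A ** B)) $ \<alpha>" for \<alpha> j A B
    by (simp add: vector_matrix_mul_assoc, simp add: vector_matrix_mult_def row_def column_def
        matrix_matrix_mult_def mult.commute)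
  have linear: "linear (\<lambda>x. (x v* ?Ad (?\<rho> 0)) $ r)"
    by (intro linearI) (simp_all add: vector_matrix_left_distrib scaleR_vector_matrix_assoc)
  have "(V_I G J0 J \<Gamma> U act \<rho> \<kappa> p C n z v* ?Ad (?\<rho> 0)) $ r
    = (\<Sum>j\<in>{- p..p}. \<Sum>\<alpha>\<in>UNIV. C j \<alpha> n (kappa_seq J0 J \<kappa> z) *
        (row \<alpha> (?\<Phi> j) v* ?Ad (?\<rho> j \<otimes> inv ?\<rho> 0) v* ?Ad (?\<rho> 0)) $ r)"
    unfolding V_I_def shift
    by (simp add: linear_sum[OF linear] linear_scale[OF linear])
  also have "\<dots> = (\<Sum>j\<in>{- p..p}. \<Sum>\<alpha>\<in>UNIV. C j \<alpha> n (kappa_seq J0 J \<kappa> z) *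
        column r (?\<Phi> j ** ?Ad (?\<rho> j)) $ \<alpha>)"
    by (intro sum.cong refl) (simp add: row Ad_split)
  finally show ?thesis .
qed

end

lemma int_interval_imp_constant:
  fixes f :: "int \<Rightarrow> 'a"
  assumes B: "int_interval B" and step: "\<And>n. n \<in> B \<Longrightarrow> n + 1 \<in> B \<Longrightarrow> f (n + 1) = f n"
  shows "\<exists>c. \<forall>n\<in>B. f n = c"
proof -
  have le: "f n = f m" if "m \<in> B" "n \<in> B" "m \<le> n" for m n
    using that(3,1,2)
  proof (induction n rule: int_ge_induct)
    case (step i)
    then have "i \<in> B" using B unfolding int_interval_def by force
    with step assms(2)[of i] show ?case by simp
  qed simp
  show ?thesis
  proof (cases "B = {}")
    case False
    then obtain m where "m \<in> B" by blast
    then have "\<forall>n\<in>B. f n = f m" using le by (metis linorder_linear)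
    then show ?thesis by blast
  qed simp
qed

lemma int_interval_base_points:
  assumes N: "int_interval N" and "J0 - M \<le> J + M"
  shows "int_interval (base_points J0 J M N)"
  unfolding int_interval_def
proof (intro ballI subsetI)
  fix a b m
  assume ab: "a \<in> base_points J0 J M N" "b \<in> base_points J0 J M N" and m: "m \<in> {a..b}"
  have "a + J0 - M \<in> N" "b + J + M \<in> N"
    using ab assms(2) by (auto simp: base_points_def)
  then have "{a + J0 - M..b + J + M} \<subseteq> N"
    using N by (simp add: int_interval_def)
  with m show "m \<in> base_points J0 J M N"
    by (auto simp: base_points_def)
qed

theorem corollary7p3:
  fixes G :: "'g monoid" and T :: "'g topology" and \<A> :: "('g, 'r::finite) chart set"
    and \<Omega> :: "(real^'r) set" and \<Gamma> :: "real^'r \<Rightarrow> 'g"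
    and U :: "(real^'q::finite) set" and act :: "'g \<Rightarrow> real^'q \<Rightarrow> real^'q"
    and J0 J J1 JL p M :: int and N :: "int set"
    and D K :: "(int \<Rightarrow> real^'q) set" and \<rho> :: "(int \<Rightarrow> real^'q) \<Rightarrow> 'g"
    and \<kappa> :: "(int \<Rightarrow> real^'q) \<Rightarrow> real^'k::finite"
    and Lu :: "(real^'q, real) dfun" and L :: "(real^'k, real) dfun"
    and H :: "'k \<Rightarrow> 'q \<Rightarrow> int \<Rightarrow> (int \<Rightarrow> real^'k) \<Rightarrow> real"
    and C :: "int \<Rightarrow> 'q \<Rightarrow> (real^'k, real) dfun"
    and u :: "int \<Rightarrow> real^'q"
  assumes "lie_group G T \<A>"
    and "parametrization_at_one G T \<A> \<Omega> \<Gamma>"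
    and "open U" and "smooth_action G \<A> U act"
    and "independent_generators \<Gamma> U act"
    and "J0 \<le> 0" and "0 \<le> J"
    and frame: "right_moving_frame G T \<A> J0 J \<Gamma> U act D K \<rho>"
    and invariants: "generating_invariants G J0 J act D \<kappa>"
    and "int_interval N"
    and orders: "0 \<le> J1" "J1 \<le> p" "2 * p + 1 \<le> M" "0 \<le> JL" "JL \<le> J + J1"
    and Lagrangian: "\<And>n. n \<in> N \<Longrightarrow> depends_on {0..JL} (Lu n)"
      "\<And>n. n \<in> N \<Longrightarrow> seq_smooth_on (Lu n) (admissible J0 J D 0 J1)"
      "\<And>n. n \<in> N \<Longrightarrow> invariant_under G act (Lu n) (admissible J0 J D 0 J1)"
    and invariantized_Lagrangian: "\<And>n. n \<in> N \<Longrightarrow> depends_on {0..J1} (L n)"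
      "\<And>n. n \<in> N \<Longrightarrow> seq_smooth_near (L n) (kappa_seq J0 J \<kappa> ` admissible J0 J D 0 J1)"
      "\<And>n z. n \<in> N \<Longrightarrow> z \<in> admissible J0 J D 0 J1 \<Longrightarrow> Lu n z = L n (kappa_seq J0 J \<kappa> z)"
    and H_coefficients: "\<And>\<beta> \<alpha> j. depends_on {- p..p} (H \<beta> \<alpha> j)"
    and "syzygies J0 J (admissible J0 J D (- M) M) act \<rho> \<kappa> p H"
    and C_coefficients: "\<And>j \<alpha> n. n \<in> N \<Longrightarrow> depends_on {- (2 * p)..2 * p} (C j \<alpha> n)"
    and boundary: "\<And>n. n \<in> base_points J0 J M N \<Longrightarrow>
      boundary_identity J0 J (admissible J0 J D (- M) M) act \<rho> \<kappa> p H J1 L C n"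
    and solution: "\<And>n. n \<in> base_points J0 J M N \<Longrightarrow>
        shift_seq n u \<in> admissible J0 J D (- M) M"
      "\<And>n \<alpha>. n \<in> base_points J0 J M N \<Longrightarrow>
        invariantized_EL p H J1 L \<alpha> n (kappa_seq J0 J \<kappa> (shift_seq n u)) = 0"
  shows "\<exists>c :: real^'r. \<forall>n \<in> base_points J0 J M N.
    V_I G J0 J \<Gamma> U act \<rho> \<kappa> p C n (shift_seq n u)
      v* Ad \<Gamma> U act (moving_frame J0 J \<rho> 0 (shift_seq n u)) = c"
proof -
  let ?X = "admissible J0 J D (- M) M"
  let ?\<rho> = "moving_frame J0 J \<rho>"
  let ?Ad = "Ad \<Gamma> U act"
  let ?f = "\<lambda>n. V_I G J0 J \<Gamma> U act \<rho> \<kappa> p C n (shift_seq n u) v* ?Ad (?\<rho> 0 (shift_seq n u))"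
  interpret lie_group G T \<A> by fact
  interpret independent_lie_action G T \<A> \<Omega> \<Gamma> U act
    by unfold_locales (use assms in auto)
  have D: "openin (top_of_set (prolong J0 J U)) D"
    and \<rho>: "\<And>x. x \<in> D \<Longrightarrow> \<rho> x \<in> carrier G"
    using frame by (auto simp: right_moving_frame_def)
  have \<kappa>: "invariant_under G act (\<lambda>z. \<kappa> (window J0 J 0 z)) (admissible J0 J D 0 0)"
    using invariants by (simp add: generating_invariants_def)
  have bounds: "0 \<le> p" "p + 1 \<le> M" "J0 \<le> J" "- M \<le> M"
    using orders \<open>J0 \<le> 0\<close> \<open>0 \<le> J\<close> by auto
  have frame_carrier: "?\<rho> j z \<in> carrier G" if "z \<in> ?X" "j \<in> {- M..M}" for j z
    using that \<rho> by (simp add: moving_frame_def admissible_def)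
  have step: "?f (n + 1) = ?f n" if n: "n \<in> base_points J0 J M N" "n + 1 \<in> base_points J0 J M N" for n
  proof -
    define z where "z = shift_seq n u"
    have z: "z \<in> ?X" using solution(1)[OF n(1)] by (simp add: z_def)
    have "?f (n + 1) $ r = ?f n $ r" for r
    proof -
      define w where "w = orbit_variation {J0 + - M..J + M} (axis r 1) z"
      define y where "y = kappa_sigma_seq J0 J act \<rho> \<kappa> w 0"
      obtain I where I: "0 \<in> I" "\<And>s. s \<in> I \<Longrightarrow> s *\<^sub>R axis r 1 \<in> \<Omega>" "variation ?X I w"
        unfolding w_def by (rule variation_orbit_variation[OF D z bounds(3,4), of "axis r 1"]) blast
      have zU: "z j \<in> U" if "j \<in> {J0 + - M..J + M}" for j
        using admissible_in_U[OF openin_imp_subset[OF D] z bounds(3,4) that] .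
      \<comment> \<open>At \<open>s = 0\<close> the variation is \<open>z\<close> itself, also outside the range of the prolongation
        space, so all shifts of \<open>\<kappa>\<close> agree with those of the solution.\<close>
      have w0: "(\<lambda>j. w j 0) = z"
        unfolding w_def by (rule orbit_variation_0[OF zU])
      have fst_y: "fst (y j) = kappa_seq J0 J \<kappa> z j" for j
        by (simp add: y_def kappa_sigma_seq_def w0)
      \<comment> \<open>The range includes \<open>p + 1\<close> because the boundary term is also shifted by one.\<close>
      have snd_y: "snd (y j) = column r (characteristics \<Gamma> act (act (?\<rho> j z) (z j)) ** ?Ad (?\<rho> j z))"
        if j: "j \<in> {- p..p + 1}" for j
      proof -
        have j': "j \<in> {- M..M}" "j \<in> {J0 + - M..J + M}"
          using j bounds \<open>J0 \<le> 0\<close> \<open>0 \<le> J\<close> by auto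
        have "w j = (\<lambda>s. act (\<Gamma> (s *\<^sub>R axis r 1)) (z j))"
          using j'(2) by (auto simp: w_def orbit_variation_def)
        then show ?thesis
          using has_vector_derivative_invariantized_generator[OF frame_carrier[OF z j'(1)] zU[OF j'(2)], of r]
          by (simp add: y_def kappa_sigma_seq_def w0 vector_derivative_at)
      qed

      \<comment> \<open>The invariants are constant along the orbit, and \<open>H \<sigma>\<close> is their derivative.\<close>
      have H0: "H_sigma p H \<beta> n y = 0" for \<beta>
      proof -
        have "((\<lambda>s. kappa_seq J0 J \<kappa> (\<lambda>i. w i s) 0) has_vector_derivative
            (\<chi> \<beta>. H_sigma p H \<beta> n y)) (at 0)"
          using \<open>syzygies J0 J ?X act \<rho> \<kappa> p H\<close> I(1,3) unfolding syzygies_def y_def by blast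
        moreover have "((\<lambda>s. kappa_seq J0 J \<kappa> (\<lambda>i. w i s) 0) has_vector_derivative 0) (at 0)"
        proof (rule has_vector_derivative_transform_within_open)
          show "open I" "0 \<in> I" using I(1,3) by (auto simp: variation_def)
          show "((\<lambda>s. kappa_seq J0 J \<kappa> z 0) has_vector_derivative 0) (at 0)" by simp
          fix s assume s: "s \<in> I"
          then have "(\<lambda>j. w j s) \<in> ?X" using I(3) by (simp add: variation_def)
          then show "kappa_seq J0 J \<kappa> z 0 = kappa_seq J0 J \<kappa> (\<lambda>i. w i s) 0"
            using kappa_seq_orbit_variation[OF \<kappa> z _ I(2)[OF s]] bounds unfolding w_def by simp
        qed
        ultimately have "(\<chi> \<beta>. H_sigma p H \<beta> n y) = 0"
          by (rule vector_derivative_unique_at)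
        then show ?thesis by (simp add: vec_eq_iff)
      qed

      \<comment> \<open>The other summand on the left of the boundary identity vanishes on solutions.\<close>
      have "on_kappa (invariantized_EL p H J1 L \<alpha>) n y = 0" for \<alpha>
        using solution(2)[OF n(1)] by (simp add: on_kappa_def fst_y z_def)
      with H0 have "Shift 1 (boundary_term p C) n y = boundary_term p C n y"
        using boundary[OF n(1)] I(1,3) unfolding boundary_identity_def y_def Let_def by fastforce
      moreover have "boundary_term p C n y = ?f n $ r"
      proof -
        have "?\<rho> j z \<in> carrier G" if "j \<in> {- p..p}" for j
          using that bounds by (intro frame_carrier[OF z]) auto
        then show ?thesis
          using V_I_Ad_component[of p J0 J \<rho> z \<kappa> C n r] bounds
          by (simp add: z_def[symmetric] boundary_term_def on_kappa_def Shift_def sigma_comp_def fst_y snd_y)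
      qed
      moreover have "Shift 1 (boundary_term p C) n y = ?f (n + 1) $ r"
      proof -
        let ?z = "shift_seq (n + 1) u"
        have "?\<rho> j ?z \<in> carrier G" if "j \<in> {- p..p}" for j
          using that bounds by (intro frame_carrier[OF solution(1)[OF n(2)]]) auto
        moreover have "?z j = z (j + 1)" "?\<rho> j ?z = ?\<rho> (j + 1) z"
          "kappa_seq J0 J \<kappa> ?z = (\<lambda>j. kappa_seq J0 J \<kappa> z (j + 1))" for j
          by (auto simp: z_def shift_seq_def moving_frame_def kappa_seq_def window_def add_ac)
        ultimately show ?thesis
          using V_I_Ad_component[of p J0 J \<rho> ?z \<kappa> C "n + 1" r] bounds
          by (simp add: boundary_term_def on_kappa_def Shift_def sigma_comp_def fst_y snd_y)
      qed
      ultimately show ?thesis by simp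
    qed
    then show ?thesis by (simp add: vec_eq_iff)
  qed
  have "int_interval (base_points J0 J M N)"
    using \<open>int_interval N\<close> bounds by (intro int_interval_base_points) auto
  then show ?thesis
    using int_interval_imp_constant[where f = ?f] step by blast
qed

end
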